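(* Let $\pi:E\to M$ be a smooth disc bundle over an oriented manifold $M$ of dimension $m$, where $M$ is identified with the zero section of $E$, and let $g$ be a Riemannian metric on $E$. Let $vol_{g_M}$ denote the volume form of $M$ induced by $g$. Then each fiber of $E$ is $g$-perpendicular to $M$ (at its intersection point with $M$) if and only if $\pi^*vol_{g_M}$ has comass one at every point of $M$, i.e. $\|\pi^*vol_{g_M}\|^*_{x,g}=1$ for all $x\in M$.
   Context: For an $m$-form $\phi$ on a Riemannian manifold $(E,g)$ the comass at $x$ is $\|\phi\|^*_{x,g}=\max\{\phi_x(V):V\text{ a simple }m\text{-vector at }x\text{ with }\|V\|_g=1\}$, where simple means $V=v_1\wedge\cdots\wedge v_m$ with $v_i\in T_xE$. *)

theory Defs
  imports "HOL-Analysis.Analysis"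
begin

section \<open>Smooth functions\<close>

text \<open>\<open>Ck_on k f U\<close> is meant for open \<open>U\<close> and finite-dimensional domain, where continuity of all
  iterated directional derivatives is equivalent to \<open>f\<close> being of class \<open>C^k\<close>.\<close>

primrec Ck_on :: "nat \<Rightarrow> ('v::euclidean_space \<Rightarrow> 'w::euclidean_space) \<Rightarrow> 'v set \<Rightarrow> bool" where
  "Ck_on 0 f U \<longleftrightarrow> continuous_on U f"
| "Ck_on (Suc k) f U \<longleftrightarrow>
     (\<forall>x\<in>U. f differentiable (at x)) \<and>
     (\<forall>v. Ck_on k (\<lambda>x. frechet_derivative f (at x) v) U)"

text \<open>On an arbitrary set, smooth means that locally there is a smooth extension to an open set;
  this is needed for charts onto relatively open subsets of a half-space.\<close>

definition smooth_on :: "'v::euclidean_space set \<Rightarrow> ('v \<Rightarrow> 'w::euclidean_space) \<Rightarrow> bool" where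
  "smooth_on S f \<longleftrightarrow>
     (\<forall>x\<in>S. \<exists>U F. open U \<and> x \<in> U \<and> (\<forall>k. Ck_on k F U) \<and> (\<forall>y\<in>U \<inter> S. F y = f y))"

section \<open>Smooth manifolds and smooth maps\<close>

text \<open>A chart is a pair of its domain and its coordinate map (irrelevant outside the domain).
  The underlying set of a manifold is the whole type of points.\<close>

type_synonym ('a, 'v) chart = "'a set \<times> ('a \<Rightarrow> 'v)"

abbreviation cinv :: "('a, 'v) chart \<Rightarrow> 'v \<Rightarrow> 'a" where
  "cinv c \<equiv> inv_into (fst c) (snd c)"

definition charts_at :: "('a, 'v) chart set \<Rightarrow> 'a \<Rightarrow> ('a, 'v) chart set" where
  "charts_at A p = {c \<in> A. p \<in> fst c}"

definition smooth_atlas_bd ::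
    "('a::{t2_space,second_countable_topology}, 'v::euclidean_space) chart set \<Rightarrow> bool" where
  "smooth_atlas_bd A \<longleftrightarrow>
     (\<Union>c\<in>A. fst c) = UNIV \<and>
     (\<forall>c\<in>A. open (fst c) \<and>
        homeomorphism (fst c) (snd c ` fst c) (snd c) (cinv c) \<and>
        (open (snd c ` fst c) \<or>
         (\<exists>b\<in>Basis. openin (top_of_set {x. 0 \<le> x \<bullet> b}) (snd c ` fst c)))) \<and>
     (\<forall>c\<in>A. \<forall>c'\<in>A. smooth_on (snd c ` (fst c \<inter> fst c')) (snd c' \<circ> cinv c))"

definition smooth_atlas ::
    "('a::{t2_space,second_countable_topology}, 'v::euclidean_space) chart set \<Rightarrow> bool" where
  "smooth_atlas A \<longleftrightarrow> smooth_atlas_bd A \<and> (\<forall>c\<in>A. open (snd c ` fst c))"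

text \<open>An orientation is given by an atlas whose coordinate changes preserve the orientation
  of \<open>real ^ 'm\<close>.\<close>

definition oriented_atlas ::
    "('a::{t2_space,second_countable_topology}, real ^ 'm) chart set \<Rightarrow> bool" where
  "oriented_atlas A \<longleftrightarrow> smooth_atlas A \<and>
     (\<forall>c\<in>A. \<forall>c'\<in>A. \<forall>p\<in>fst c \<inter> fst c'.
        0 < det (matrix (frechet_derivative (snd c' \<circ> cinv c) (at (snd c p)))))"

definition smooth_map ::
    "('a::topological_space, 'v::euclidean_space) chart set \<Rightarrow>
     ('b::topological_space, 'w::euclidean_space) chart set \<Rightarrow> 'a set \<Rightarrow> ('a \<Rightarrow> 'b) \<Rightarrow> bool" where
  "smooth_map A B S f \<longleftrightarrow> continuous_on S f \<and>
     (\<forall>c\<in>A. \<forall>c'\<in>B.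
        smooth_on (snd c ` (fst c \<inter> S \<inter> f -` fst c')) (snd c' \<circ> f \<circ> cinv c))"

definition real_atlas :: "(real, real) chart set" where
  "real_atlas = {(UNIV, id)}"

definition times_vec_atlas :: "('a, 'v) chart set \<Rightarrow> ('a \<times> 'w, 'v \<times> 'w) chart set" where
  "times_vec_atlas A = (\<lambda>c. (fst c \<times> UNIV, map_prod (snd c) id)) ` A"

section \<open>Tangent vectors\<close>

text \<open>A tangent vector at \<open>p\<close> is the family of its coordinate representations in all charts
  around \<open>p\<close>, transforming by the derivatives of the coordinate changes (and \<open>0\<close> at all other
  pairs, so that equality of tangent vectors is equality of functions). Derivatives are taken
  within the chart image to cover boundary points; they are unique there.\<close>

type_synonym ('a, 'v) tvec = "('a, 'v) chart \<Rightarrow> 'v"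

definition chart_deriv ::
    "('a, 'v::euclidean_space) chart \<Rightarrow> ('b, 'w::euclidean_space) chart \<Rightarrow> ('a \<Rightarrow> 'b) \<Rightarrow>
     'a \<Rightarrow> 'v \<Rightarrow> 'w" where
  "chart_deriv c c' f p =
     frechet_derivative (snd c' \<circ> f \<circ> cinv c)
       (at (snd c p) within snd c ` (fst c \<inter> f -` fst c'))"

definition tangent_space ::
    "('a, 'v::euclidean_space) chart set \<Rightarrow> 'a \<Rightarrow> ('a, 'v) tvec set" where
  "tangent_space A p =
     {v. (\<forall>c. c \<notin> charts_at A p \<longrightarrow> v c = 0) \<and>
         (\<forall>c\<in>charts_at A p. \<forall>c'\<in>charts_at A p. v c' = chart_deriv c c' id p (v c))}"

definition tcomb ::
    "real \<Rightarrow> ('a, 'v::euclidean_space) tvec \<Rightarrow> real \<Rightarrow> ('a, 'v) tvec \<Rightarrow> ('a, 'v) tvec" where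
  "tcomb a v b w = (\<lambda>c. a *\<^sub>R v c + b *\<^sub>R w c)"

text \<open>The tangent vector at \<open>p\<close> whose representation in the chart \<open>c\<close> is \<open>u\<close>.\<close>

definition chart_vec ::
    "('a, 'v::euclidean_space) chart set \<Rightarrow> 'a \<Rightarrow> ('a, 'v) chart \<Rightarrow> 'v \<Rightarrow> ('a, 'v) tvec" where
  "chart_vec A p c u = (\<lambda>c'. if c' \<in> charts_at A p then chart_deriv c c' id p u else 0)"

text \<open>By the chain rule the result does not depend on the chosen chart.\<close>

definition tangent_map ::
    "('a, 'v::euclidean_space) chart set \<Rightarrow> ('b, 'w::euclidean_space) chart set \<Rightarrow>
     ('a \<Rightarrow> 'b) \<Rightarrow> 'a \<Rightarrow> ('a, 'v) tvec \<Rightarrow> ('b, 'w) tvec" where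
  "tangent_map A B f p v =
     (let c = (SOME c. c \<in> charts_at A p)
      in (\<lambda>c'. if c' \<in> charts_at B (f p) then chart_deriv c c' f p (v c) else 0))"

text \<open>The tangent space at \<open>p\<close> of a submanifold \<open>S\<close> of the manifold with atlas \<open>A\<close>:
  the velocities at \<open>p\<close> of smooth curves in \<open>S\<close>
  (\<open>p\<close> is assumed not to be a boundary point of \<open>S\<close>).\<close>

definition submanifold_tangent_space ::
    "('a::topological_space, 'v::euclidean_space) chart set \<Rightarrow> 'a set \<Rightarrow> 'a \<Rightarrow> ('a, 'v) tvec set"
  where
  "submanifold_tangent_space A S p =
     {v \<in> tangent_space A p. \<exists>\<gamma> e. 0 < e \<and> smooth_map real_atlas A {-e<..<e} \<gamma> \<and>
        \<gamma> ` {-e<..<e} \<subseteq> S \<and> \<gamma> 0 = p \<and>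
        (\<forall>c\<in>charts_at A p. ((snd c \<circ> \<gamma>) has_vector_derivative v c) (at 0))}"

section \<open>Riemannian metrics and volume forms\<close>

type_synonym ('a, 'v) metric_field = "'a \<Rightarrow> ('a, 'v) tvec \<Rightarrow> ('a, 'v) tvec \<Rightarrow> real"

definition riemannian_metric ::
    "('a, 'v::euclidean_space) chart set \<Rightarrow> ('a, 'v) metric_field \<Rightarrow> bool" where
  "riemannian_metric A g \<longleftrightarrow>
     (\<forall>p. \<forall>u\<in>tangent_space A p. \<forall>v\<in>tangent_space A p. g p u v = g p v u) \<and>
     (\<forall>p. \<forall>u\<in>tangent_space A p. \<forall>v\<in>tangent_space A p. \<forall>w\<in>tangent_space A p. \<forall>a b.
        g p (tcomb a u b v) w = a * g p u w + b * g p v w) \<and>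
     (\<forall>p. \<forall>v\<in>tangent_space A p. v \<noteq> (\<lambda>_. 0) \<longrightarrow> 0 < g p v v) \<and>
     (\<forall>c\<in>A. \<forall>u w. smooth_on (snd c ` fst c)
        (\<lambda>y. g (cinv c y) (chart_vec A (cinv c y) c u) (chart_vec A (cinv c y) c w)))"

definition pullback_metric ::
    "('a, 'v::euclidean_space) chart set \<Rightarrow> ('b, 'w::euclidean_space) chart set \<Rightarrow> ('a \<Rightarrow> 'b) \<Rightarrow>
     ('b, 'w) metric_field \<Rightarrow> ('a, 'v) metric_field" where
  "pullback_metric A B f g p v w =
     g (f p) (tangent_map A B f p v) (tangent_map A B f p w)"

text \<open>An \<open>m\<close>-form is evaluated at a point on \<open>m\<close>-tuples of tangent vectors, which are indexed by
  a finite type \<open>'m\<close> with \<open>CARD('m) = m\<close>.\<close>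

type_synonym ('a, 'v, 'm) form = "'a \<Rightarrow> ('m \<Rightarrow> ('a, 'v) tvec) \<Rightarrow> real"

definition pullback_form ::
    "('a, 'v::euclidean_space) chart set \<Rightarrow> ('b, 'w::euclidean_space) chart set \<Rightarrow> ('a \<Rightarrow> 'b) \<Rightarrow>
     ('b, 'w, 'm) form \<Rightarrow> ('a, 'v, 'm) form" where
  "pullback_form A B f \<omega> p v = \<omega> (f p) (\<lambda>i. tangent_map A B f p (v i))"

text \<open>In the chart \<open>c\<close> of an oriented atlas the volume form is
  \<open>sqrt (det (h\<^sub>i\<^sub>j)) dx\<^sub>1 \<and> \<dots> \<and> dx\<^sub>m\<close>; it does not depend on the chart.\<close>

definition volume_form ::
    "('a, real ^ 'm) chart set \<Rightarrow> ('a, real ^ 'm) metric_field \<Rightarrow> ('a, real ^ 'm, 'm) form" where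
  "volume_form A h p w =
     (let c = (SOME c. c \<in> charts_at A p)
      in sqrt (det (\<chi> i j. h p (chart_vec A p c (axis i 1)) (chart_vec A p c (axis j 1)))) *
         det (\<chi> i j. w j c $ i))"

section \<open>Simple multivectors and comass\<close>

definition alternating_forms ::
    "('a, 'v::euclidean_space) chart set \<Rightarrow> 'a \<Rightarrow> (('m \<Rightarrow> ('a, 'v) tvec) \<Rightarrow> real) set" where
  "alternating_forms A p =
     {\<omega>. (\<forall>v i u w a b. range v \<subseteq> tangent_space A p \<and> u \<in> tangent_space A p \<and>
             w \<in> tangent_space A p \<longrightarrow>
             \<omega> (v(i := tcomb a u b w)) = a * \<omega> (v(i := u)) + b * \<omega> (v(i := w))) \<and>
         (\<forall>v i j. range v \<subseteq> tangent_space A p \<and> i \<noteq> j \<and> v i = v j \<longrightarrow> \<omega> v = 0)}"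

text \<open>The \<open>m\<close>-vectors at \<open>p\<close> are represented as elements of the dual of the space of alternating
  \<open>m\<close>-forms on the tangent space at \<open>p\<close>; \<open>V \<omega>\<close> is the value of \<open>\<omega>\<close> on the \<open>m\<close>-vector \<open>V\<close>.\<close>

type_synonym ('a, 'v, 'm) mvec = "(('m \<Rightarrow> ('a, 'v) tvec) \<Rightarrow> real) \<Rightarrow> real"

definition wedge ::
    "('a, 'v::euclidean_space) chart set \<Rightarrow> 'a \<Rightarrow> ('m \<Rightarrow> ('a, 'v) tvec) \<Rightarrow> ('a, 'v, 'm) mvec" where
  "wedge A p v = restrict (\<lambda>\<omega>. \<omega> v) (alternating_forms A p)"

definition simple_mvecs ::
    "('a, 'v::euclidean_space) chart set \<Rightarrow> 'a \<Rightarrow> ('a, 'v, 'm) mvec set" where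
  "simple_mvecs A p = {wedge A p v | v. range v \<subseteq> tangent_space A p}"

definition gram :: "('t \<Rightarrow> 't \<Rightarrow> real) \<Rightarrow> ('m \<Rightarrow> 't) \<Rightarrow> ('m \<Rightarrow> 't) \<Rightarrow> real ^ 'm ^ 'm" where
  "gram G v w = (\<chi> i j. G (v i) (w j))"

text \<open>The norm of a simple \<open>m\<close>-vector for the inner product on \<open>m\<close>-vectors induced by \<open>g\<close>, under
  which \<open>v\<^sub>1 \<and> \<dots> \<and> v\<^sub>m\<close> and \<open>w\<^sub>1 \<and> \<dots> \<and> w\<^sub>m\<close> have the product \<open>det (g v\<^sub>i w\<^sub>j)\<close>. Lemma
  \<open>simple_norm_wedge\<close> below shows that it is well defined.\<close>

definition simple_norm ::
    "('a, 'v::euclidean_space) chart set \<Rightarrow> ('a, 'v) metric_field \<Rightarrow> 'a \<Rightarrow>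
     ('a, 'v, 'm::finite) mvec \<Rightarrow> real" where
  "simple_norm A g p V =
     (THE r. \<exists>v. range v \<subseteq> tangent_space A p \<and> V = wedge A p v \<and>
        r = sqrt (det (gram (g p) v v)))"

definition comass ::
    "('a, 'v::euclidean_space) chart set \<Rightarrow> ('a, 'v) metric_field \<Rightarrow> 'a \<Rightarrow>
     ('a, 'v, 'm::finite) form \<Rightarrow> real" where
  "comass A g p \<phi> =
     (GREATEST r. \<exists>V\<in>simple_mvecs A p. simple_norm A g p V = 1 \<and> r = V (\<phi> p))"

lemma gram_alternating:
  fixes a :: "'m::finite \<Rightarrow> ('a, 'v::euclidean_space) tvec"
  assumes g: "riemannian_metric A g" and a: "range a \<subseteq> tangent_space A p"
  shows "(\<lambda>v. det (gram (g p) v a)) \<in> alternating_forms A p"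
proof -
  have lin: "g p (tcomb x u y w) z = x * g p u z + y * g p w z"
    if "u \<in> tangent_space A p" "w \<in> tangent_space A p" "z \<in> tangent_space A p" for x y u w z
    using g that unfolding riemannian_metric_def by blast
  have "det (gram (g p) (v(i := tcomb x u y w)) a) =
        x * det (gram (g p) (v(i := u)) a) + y * det (gram (g p) (v(i := w)) a)"
    if "u \<in> tangent_space A p" "w \<in> tangent_space A p" for v i u w x y
  proof -
    have "det (gram (g p) (v(i := z)) a) =
          det (\<chi> k. if k = i then (\<chi> j. g p z (a j)) else (\<chi> j. g p (v k) (a j)))" for z
      by (rule arg_cong[where f = det]) (simp add: gram_def vec_eq_iff)
    moreover have "(\<chi> j. g p (tcomb x u y w) (a j)) =
          x *s (\<chi> j. g p u (a j)) + y *s (\<chi> j. g p w (a j))"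
      using a that by (auto simp: vec_eq_iff intro!: lin)
    moreover have "det (\<chi> k. if k = i then x *s r + y *s r' else c k) =
          x * det (\<chi> k. if k = i then r else c k) + y * det (\<chi> k. if k = i then r' else c k)"
      for r r' :: "real ^ 'm" and c
      unfolding det_row_add[of i "\<lambda>_. x *s r" "\<lambda>_. y *s r'" c]
        det_row_mul[of i x "\<lambda>_. r" c] det_row_mul[of i y "\<lambda>_. r'" c] ..
    ultimately show ?thesis
      by (simp only:)
  qed
  moreover have "det (gram (g p) v a) = 0" if "i \<noteq> j" "v i = v j" for v i j
    by (rule det_identical_rows[OF that(1)]) (simp add: row_def gram_def vec_eq_iff that)
  ultimately show ?thesis
    unfolding alternating_forms_def by auto
qed

lemma simple_norm_wedge:
  fixes v :: "'m::finite \<Rightarrow> ('a, 'v::euclidean_space) tvec"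
  assumes g: "riemannian_metric A g" and v: "range v \<subseteq> tangent_space A p"
  shows "simple_norm A g p (wedge A p v) = sqrt (det (gram (g p) v v))"
proof -
  have "det (gram (g p) w w) = det (gram (g p) v v)"
    if w: "range w \<subseteq> tangent_space A p" and eq: "wedge A p v = wedge A p w"
    for w :: "'m \<Rightarrow> ('a, 'v) tvec"
  proof -
    have key: "det (gram (g p) v a) = det (gram (g p) w a)"
      if "range a \<subseteq> tangent_space A p" for a
      using fun_cong[OF eq, of "\<lambda>v. det (gram (g p) v a)"] gram_alternating[OF g that]
      by (simp add: wedge_def)
    have "g p (v i) (w j) = g p (w j) (v i)" for i j
      using g v w unfolding riemannian_metric_def by blast
    then have "gram (g p) v w = transpose (gram (g p) w v)"
      by (simp add: gram_def transpose_def vec_eq_iff)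
    with key[OF v] key[OF w] show ?thesis
      by (simp add: det_transpose)
  qed
  then have "r = sqrt (det (gram (g p) v v))"
    if "\<exists>w. range w \<subseteq> tangent_space A p \<and> wedge A p v = wedge A p w \<and>
          r = sqrt (det (gram (g p) w w))" for r
    using that by auto
  moreover have "\<exists>w. range w \<subseteq> tangent_space A p \<and> wedge A p v = wedge A p w \<and>
      sqrt (det (gram (g p) v v)) = sqrt (det (gram (g p) w w))"
    using v by blast
  ultimately show ?thesis
    unfolding simple_norm_def by (intro the_equality)
qed

section \<open>Disc bundles\<close>

text \<open>The fibre \<open>D\<close> is the unit disc, open or closed, in \<open>real ^ 'k\<close>. In the closed case the total
  space is a manifold with boundary, and smoothness on \<open>U \<times> D\<close> is understood in \<open>M \<times> real ^ 'k\<close>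
  via local extensions. The local trivialisations identify the zero section \<open>\<sigma>\<close> with the centres
  of the discs; no linear structure on the fibres is required.\<close>

definition local_trivialisation ::
    "('e::topological_space, real ^ 'n) chart set \<Rightarrow> ('b::topological_space, real ^ 'm) chart set \<Rightarrow>
     (real ^ 'k) set \<Rightarrow> ('e \<Rightarrow> 'b) \<Rightarrow> ('b \<Rightarrow> 'e) \<Rightarrow> 'b set \<Rightarrow> ('e \<Rightarrow> 'b \<times> (real ^ 'k)) \<Rightarrow> bool" where
  "local_trivialisation EA MA D \<pi> \<sigma> U \<Phi> \<longleftrightarrow>
     open U \<and> bij_betw \<Phi> (\<pi> -` U) (U \<times> D) \<and>
     (\<forall>p\<in>\<pi> -` U. fst (\<Phi> p) = \<pi> p) \<and>
     smooth_map EA (times_vec_atlas MA) (\<pi> -` U) \<Phi> \<and>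
     smooth_map (times_vec_atlas MA) EA (U \<times> D) (inv_into (\<pi> -` U) \<Phi>) \<and>
     (\<forall>x\<in>U. \<Phi> (\<sigma> x) = (x, 0))"

definition disc_bundle ::
    "('e::{t2_space,second_countable_topology}, real ^ 'n) chart set \<Rightarrow>
     ('b::{t2_space,second_countable_topology}, real ^ 'm) chart set \<Rightarrow>
     (real ^ 'k) set \<Rightarrow> ('e \<Rightarrow> 'b) \<Rightarrow> ('b \<Rightarrow> 'e) \<Rightarrow> bool" where
  "disc_bundle EA MA D \<pi> \<sigma> \<longleftrightarrow>
     smooth_atlas_bd EA \<and> smooth_atlas MA \<and>
     (D = ball 0 1 \<or> D = cball 0 1) \<and>
     smooth_map EA MA UNIV \<pi> \<and> smooth_map MA EA UNIV \<sigma> \<and> (\<forall>x. \<pi> (\<sigma> x) = x) \<and>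
     (\<forall>x. \<exists>U \<Phi>. x \<in> U \<and> local_trivialisation EA MA D \<pi> \<sigma> U \<Phi>)"

definition perpendicular_at ::
    "('a::topological_space, 'v::euclidean_space) chart set \<Rightarrow> ('a, 'v) metric_field \<Rightarrow> 'a \<Rightarrow>
     'a set \<Rightarrow> 'a set \<Rightarrow> bool" where
  "perpendicular_at A g p S T \<longleftrightarrow>
     (\<forall>v\<in>submanifold_tangent_space A S p. \<forall>w\<in>submanifold_tangent_space A T p. g p v w = 0)"

end

theory Submission
  imports Defs
begin

text \<open>The comparison is made separately at each point \<open>p = \<sigma> x\<close> of the zero section. Let
  \<open>P = d\<pi>\<^sub>p\<close> and \<open>S = d\<sigma>\<^sub>x\<close>, so that \<open>P \<circ> S = id\<close>. The tangent space of the fibre is \<open>ker P\<close> and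
  that of the zero section is \<open>im S\<close>, so perpendicularity means \<open>ker P \<bottom> im S\<close>. In a chart of \<open>M\<close>
  the pulled-back volume form is
  \<open>v \<mapsto> sqrt (det (g (S e\<^sub>i) (S e\<^sub>j))) * det (P v\<^sub>1, \<dots>, P v\<^sub>m)\<close>.

  Choose coordinates on the tangent space at \<open>p\<close> in which \<open>g\<close> is the Euclidean inner product, and
  write \<open>X\<close> for the transpose of \<open>P\<close>. For a matrix \<open>Y\<close> with columns \<open>v\<^sub>1, \<dots>, v\<^sub>m\<close>, the
  Cauchy-Schwarz inequality for simple \<open>m\<close>-vectors (\<open>det_Cauchy_Schwarz\<close>),
  \<open>(det (X\<^sup>T Y))\<^sup>2 \<le> det (X\<^sup>T X) * det (Y\<^sup>T Y)\<close>,
  shows that the comass is \<open>sqrt (det (S\<^sup>T S) * det (X\<^sup>T X))\<close>, and that the maximum is attained on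
  the columns of \<open>X\<close>, suitably scaled. Since \<open>X\<^sup>T S = P S = 1\<close>, the comass is \<open>1\<close> exactly when \<open>X\<close> and \<open>S\<close>
  give equality in Cauchy-Schwarz, that is, when the columns of \<open>S\<close> lie in the column space of \<open>X\<close>.
  This space is the orthogonal complement of \<open>ker P\<close>, so the condition is again \<open>ker P \<bottom> im S\<close>
  (\<open>max_pulled_back_volume_eq_1_iff\<close>). The inequality itself reduces, after an orthogonal
  projection to the column space of \<open>X\<close>, to \<open>det A \<le> det (A + N\<^sup>T N)\<close> for positive definite \<open>A\<close>,
  where \<open>N\<^sup>T N\<close> is a sum of matrices of rank one.

  On the geometric side the work lies in the two descriptions of tangent spaces by velocities
  of smooth curves. The inclusions into \<open>ker P\<close> and \<open>im S\<close> are the chain rule. For the converses the curves are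
  images of affine coordinate lines: under \<open>\<sigma>\<close> for the zero section, and under the inverse of a local
  trivialisation for the fibre (\<open>zero_section_tangent_space\<close>, \<open>fibre_tangent_superset\<close>). Only
  lines are used, so smoothness of the curves needs only the restriction of a smooth
  function to a line instead of a general composition theorem.\<close>

section \<open>Gram determinants\<close>

text \<open>The Gram-Schmidt process for an arbitrary inner product \<open>G\<close>, which need not be the one of the
  type.\<close>

lemma orthonormal_family_exists:
  fixes G :: "'a::euclidean_space \<Rightarrow> 'a \<Rightarrow> real"
  assumes bil: "bilinear G" and sym: "\<And>u v. G u v = G v u" and pos: "\<And>v. v \<noteq> 0 \<Longrightarrow> 0 < G v v"
    and "finite F"
  shows "\<exists>B. finite B \<and> (\<forall>e\<in>B. \<forall>e'\<in>B. G e e' = (if e = e' then 1 else 0)) \<and> span B = span F"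
  using \<open>finite F\<close>
proof induction
  case empty
  then show ?case by (intro exI[of _ "{}"]) simp
next
  case (insert f F)
  then obtain B where B: "finite B" "\<And>e e'. e \<in> B \<Longrightarrow> e' \<in> B \<Longrightarrow> G e e' = (if e = e' then 1 else 0)"
    "span B = span F" by blast
  \<comment> \<open>The \<open>G\<close>-orthogonal projection of \<open>f\<close> to the span of \<open>B\<close>.\<close>
  define p where "p = (\<Sum>e\<in>B. G f e *\<^sub>R e)"
  have pB: "p \<in> span B"
    unfolding p_def by (intro span_sum span_scale span_base)
  have linl: "linear (\<lambda>u. G u v)" and linr: "linear (G v)" for v
    using bil by (auto simp: bilinear_def)
  show ?case
  proof (cases "f = p")
    case True
    then have "span (insert f F) = span F"
      using pB B(3) by (simp add: span_redundant)
    then show ?thesis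
      using B by (intro exI[of _ B]) auto
  next
    case False
    define q where "q = f - p"
    have "q \<noteq> 0" using False by (simp add: q_def)
    then have q0: "0 < G q q" by (rule pos)
    have Gq: "G q e = 0" if "e \<in> B" for e
    proof -
      have "G p e = (\<Sum>e'\<in>B. G f e' * G e' e)"
        unfolding p_def linear_sum[OF linl] by (simp add: linear_cmul[OF linl])
      also have "\<dots> = (\<Sum>e'\<in>B. if e' = e then G f e else 0)"
        using that by (intro sum.cong) (auto simp: B(2))
      also have "\<dots> = G f e"
        using that B(1) by simp
      finally show ?thesis
        by (simp add: q_def linear_diff[OF linl])
    qed
    define e0 where "e0 = (1 / sqrt (G q q)) *\<^sub>R q"
    have e0: "G e0 e0 = 1"
      using q0 by (simp add: e0_def linear_cmul[OF linl] linear_cmul[OF linr])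
    have e0B: "G e0 e = 0" "G e e0 = 0" if "e \<in> B" for e
      using Gq[OF that] sym[of e q] by (simp_all add: e0_def linear_cmul[OF linl] linear_cmul[OF linr])
    have sp: "span (insert e0 B) = span (insert f F)"
    proof -
      have "f = sqrt (G q q) *\<^sub>R e0 + p"
        using q0 by (simp add: e0_def q_def)
      moreover have "e0 \<in> span (insert e0 B)" "p \<in> span (insert e0 B)"
        using pB by (auto intro: span_base span_mono[THEN subsetD])
      ultimately have f: "f \<in> span (insert e0 B)"
        by (metis span_add span_scale)
      have "p \<in> span (insert f F)"
        using pB B(3) span_mono[of F "insert f F"] by auto
      then have "e0 \<in> span (insert f F)"
        unfolding e0_def q_def by (intro span_scale span_diff) (auto intro: span_base)
      moreover have "B \<subseteq> span (insert f F)"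
        using B(3) span_superset[of B] span_mono[of F "insert f F"] by auto
      moreover have "F \<subseteq> span (insert e0 B)"
        using B(3) span_superset[of F] span_mono[of B "insert e0 B"] by auto
      ultimately show ?thesis
        using f by (intro span_eq[THEN iffD2]) auto
    qed
    show ?thesis
      using B(1,2) e0 e0B sp by (intro exI[of _ "insert e0 B"]) (simp; metis zero_neq_one)
  qed
qed

text \<open>The matrix \<open>\<Lambda>\<close> takes a vector to its coordinates in a \<open>G\<close>-orthonormal basis. It makes it
  possible to replace any inner product by the Euclidean one.\<close>

lemma posdef_form_eq_inner:
  fixes G :: "real ^ 'n \<Rightarrow> real ^ 'n \<Rightarrow> real"
  assumes bil: "bilinear G" and sym: "\<And>u v. G u v = G v u" and pos: "\<And>v. v \<noteq> 0 \<Longrightarrow> 0 < G v v"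
  obtains \<Lambda> :: "real ^ 'n ^ 'n" where "invertible \<Lambda>" "\<And>u v. G u v = (\<Lambda> *v u) \<bullet> (\<Lambda> *v v)"
proof -
  have linl: "linear (\<lambda>u. G u v)" and linr: "linear (G v)" for v
    using bil by (auto simp: bilinear_def)
  obtain B where B: "finite B" "\<And>e e'. e \<in> B \<Longrightarrow> e' \<in> B \<Longrightarrow> G e e' = (if e = e' then 1 else 0)"
    "span B = UNIV"
    using orthonormal_family_exists[OF assms finite_Basis] by (metis span_Basis)
  have expand: "u = (\<Sum>e\<in>B. G u e *\<^sub>R e)" for u
  proof -
    obtain a where u: "u = (\<Sum>e\<in>B. a e *\<^sub>R e)"
      using span_finite[OF B(1)] B(3) by blast
    have "G u e = a e" if "e \<in> B" for e
    proof -
      have "G u e = (\<Sum>e'\<in>B. a e' * G e' e)"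
        unfolding u linear_sum[OF linl] by (simp add: linear_cmul[OF linl])
      also have "\<dots> = (\<Sum>e'\<in>B. if e' = e then a e else 0)"
        using that by (intro sum.cong) (auto simp: B(2))
      finally show ?thesis
        using that B(1) by simp
    qed
    then show ?thesis
      using u by simp
  qed
  have "independent B"
  proof (rule independent_if_scalars_zero[OF B(1)])
    fix a e assume *: "(\<Sum>x\<in>B. a x *\<^sub>R x) = 0" "e \<in> B"
    have "0 = G (\<Sum>x\<in>B. a x *\<^sub>R x) e"
      unfolding * by (simp add: linear_0[OF linl])
    also have "\<dots> = (\<Sum>e'\<in>B. a e' * G e' e)"
      unfolding linear_sum[OF linl] by (simp add: linear_cmul[OF linl])
    also have "\<dots> = (\<Sum>e'\<in>B. if e' = e then a e else 0)"
      using * by (intro sum.cong) (auto simp: B(2))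
    finally show "a e = 0"
      using * B(1) by simp
  qed
  then have "card B = CARD('n)"
    using B(3) by (metis basis_card_eq_dim dim_UNIV DIM_cart DIM_real mult.right_neutral subset_UNIV order_refl)
  then obtain f :: "'n \<Rightarrow> real ^ 'n" where f: "bij_betw f UNIV B"
    using finite_same_card_bij[of "UNIV :: 'n set" B] B(1) by auto
  define L where "L u = (\<chi> i. G u (f i))" for u
  have L: "linear L"
    unfolding L_def by (intro linearI) (simp_all add: vec_eq_iff linear_add[OF linl] linear_cmul[OF linl])
  have GL: "G u v = L u \<bullet> L v" for u v
  proof -
    have "G u v = G (\<Sum>e\<in>B. G u e *\<^sub>R e) v"
      using expand[of u] by simp
    also have "\<dots> = (\<Sum>e\<in>B. G u e * G v e)"
      unfolding linear_sum[OF linl] by (simp add: linear_cmul[OF linl], simp add: sym[of _ v] linear_cmul[OF linr])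
    also have "\<dots> = (\<Sum>i\<in>UNIV. G u (f i) * G v (f i))"
      by (rule sum.reindex_bij_betw[OF f, symmetric])
    finally show ?thesis
      by (simp add: L_def inner_vec_def)
  qed
  have "inj L"
    unfolding linear_injective_0[OF L] using GL pos by (metis inner_zero_left less_irrefl)
  then have "invertible (matrix L)"
    using matrix_works[of L] L
    by (simp add: invertible_left_inverse matrix_left_invertible_injective inj_def)
  moreover have "G u v = (matrix L *v u) \<bullet> (matrix L *v v)" for u v
    by (simp add: GL matrix_works L)
  ultimately show thesis
    by (rule that)
qed

text \<open>The matrix \<open>b b\<^sup>T\<close>.\<close>

definition outer :: "real ^ 'm \<Rightarrow> real ^ 'm ^ 'm" where
  "outer b = (\<chi> i j. b $ i * b $ j)"

lemma det_eq_0_iff_kernel: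
  fixes A :: "real ^ 'm ^ 'm"
  shows "det A = 0 \<longleftrightarrow> (\<exists>z. z \<noteq> 0 \<and> A *v z = 0)"
  using invertible_det_nz[of A] invertible_left_inverse[of A] matrix_left_invertible_ker[of A] by auto

lemma zero_matrix_mult: "(0 :: 'a::semiring_1 ^ 'n ^ 'm) ** (A :: 'a ^ 'k ^ 'n) = 0"
  by (simp add: matrix_matrix_mult_def vec_eq_iff)

lemma transpose_zero: "transpose (0 :: 'a::zero ^ 'n ^ 'm) = 0"
  by (simp add: transpose_def vec_eq_iff)

lemma transpose_add: "transpose (A + B :: 'a::plus ^ 'n ^ 'm) = transpose A + transpose B"
  by (simp add: transpose_def vec_eq_iff)

lemma outer_mult: "outer b *v v = (b \<bullet> v) *\<^sub>R b"
  by (simp add: outer_def matrix_vector_mult_def vec_eq_iff inner_vec_def sum_distrib_left ac_simps)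

lemma inner_matrix_mult: "u \<bullet> (A *v v) = (transpose A *v u) \<bullet> (v :: real ^ 'n)"
  by (simp add: dot_lmul_matrix)

lemma matrix_add_mult: "(A + B) ** C = A ** C + B ** (C :: real ^ 'n ^ 'k)"
  by (simp add: matrix_matrix_mult_def vec_eq_iff algebra_simps sum.distrib)

lemma outer_conjugate: "Q ** outer b ** transpose Q = outer (Q *v b)"
proof -
  have "(Q ** outer b ** transpose Q) *v v = outer (Q *v b) *v v" for v
    by (simp flip: matrix_vector_mul_assoc add: outer_mult matrix_vector_mult_scaleR
        inner_matrix_mult del: transpose_matrix_vector)
  then show ?thesis
    by (simp add: matrix_eq)
qed

text \<open>An orthogonal change of coordinates turns \<open>b\<close> into a multiple of a basis vector, and then the
  matrix is diagonal with only one entry different from \<open>1\<close>.\<close>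

lemma det_mat_1_plus_outer:
  fixes b :: "real ^ 'm"
  shows "det (mat 1 + outer b) = 1 + (norm b)\<^sup>2"
proof -
  obtain k :: 'm where True by simp
  have "norm b = norm (norm b *\<^sub>R (axis k 1 :: real ^ 'm))"
    by simp
  from orthogonal_transformation_exists[OF this] obtain f :: "real ^ 'm \<Rightarrow> real ^ 'm"
    where f: "orthogonal_transformation f" "f b = norm b *\<^sub>R axis k 1" by blast
  define Q where "Q = matrix f"
  have Q: "orthogonal_matrix Q"
    using f(1) by (simp add: Q_def orthogonal_transformation_matrix)
  have Qb: "Q *v b = norm b *\<^sub>R axis k 1"
    using f by (simp add: Q_def orthogonal_transformation_linear matrix_works)
  have "Q ** (mat 1 + outer b) ** transpose Q = mat 1 + outer (Q *v b)"
    using Q by (simp add: matrix_add_ldistrib matrix_add_mult outer_conjugate orthogonal_matrix_def)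
  then have "det Q * det (mat 1 + outer b) * det Q = det (mat 1 + outer (Q *v b))"
    by (metis det_mul det_transpose)
  also have "det Q * det (mat 1 + outer b) * det Q = det (mat 1 + outer b)"
    using det_orthogonal_matrix[OF Q] by auto
  also have "det (mat 1 + outer (Q *v b)) = (\<Prod>i\<in>UNIV. if i = k then 1 + (norm b)\<^sup>2 else 1)"
    by (subst det_diagonal)
       (auto simp: Qb outer_def mat_def axis_def power2_eq_square if_distrib cong: if_cong intro!: prod.cong)
  finally show ?thesis
    by simp
qed

definition posdef :: "real ^ 'm ^ 'm \<Rightarrow> bool" where
  "posdef A \<longleftrightarrow> transpose A = A \<and> (\<forall>v. v \<noteq> 0 \<longrightarrow> 0 < v \<bullet> (A *v v))"

lemma posdef_factor:
  fixes A :: "real ^ 'm ^ 'm"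
  assumes "posdef A"
  obtains \<Lambda> :: "real ^ 'm ^ 'm" where "invertible \<Lambda>" "A = transpose \<Lambda> ** \<Lambda>"
proof -
  have "bilinear (\<lambda>u v. u \<bullet> (A *v v))"
    unfolding bilinear_def
    by (auto intro!: linearI simp: inner_add_left inner_add_right matrix_vector_right_distrib
        matrix_vector_mult_scaleR)
  moreover have "u \<bullet> (A *v v) = v \<bullet> (A *v u)" for u v
    using assms by (metis posdef_def inner_matrix_mult inner_commute)
  ultimately obtain \<Lambda> :: "real ^ 'm ^ 'm" where \<Lambda>: "invertible \<Lambda>" 
    "\<And>u v. u \<bullet> (A *v v) = (\<Lambda> *v u) \<bullet> (\<Lambda> *v v)"
    using posdef_form_eq_inner[of "\<lambda>u v. u \<bullet> (A *v v)"] assms by (auto simp: posdef_def)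
  have "u \<bullet> (A *v v) = u \<bullet> ((transpose \<Lambda> ** \<Lambda>) *v v)" for u v
    unfolding \<Lambda>(2) matrix_vector_mul_assoc[symmetric] inner_matrix_mult[of u "transpose \<Lambda>"]
    by simp
  then have "A = transpose \<Lambda> ** \<Lambda>"
    by (metis matrix_eq vector_eq_ldot)
  with \<Lambda>(1) show thesis
    by (rule that)
qed

lemma det_posdef_pos:
  fixes A :: "real ^ 'm ^ 'm"
  assumes "posdef A"
  shows "0 < det A"
proof -
  obtain \<Lambda> :: "real ^ 'm ^ 'm" where \<Lambda>: "invertible \<Lambda>" "A = transpose \<Lambda> ** \<Lambda>"
    by (rule posdef_factor[OF assms])
  have "det A = (det \<Lambda>)\<^sup>2"
    by (simp add: \<Lambda>(2) det_mul power2_eq_square)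
  with \<Lambda>(1) show ?thesis
    by (simp add: invertible_det_nz)
qed

lemma posdef_add_outer:
  assumes "posdef A" shows "posdef (A + outer b)"
proof -
  have "transpose (outer b) = outer b"
    unfolding outer_def transpose_def by (simp only: vec_lambda_beta mult.commute)
  moreover have "0 < v \<bullet> ((A + outer b) *v v)" if "v \<noteq> 0" for v
  proof -
    have "v \<bullet> ((A + outer b) *v v) = v \<bullet> (A *v v) + (b \<bullet> v)\<^sup>2"
      unfolding matrix_vector_mult_add_rdistrib outer_mult inner_add_right inner_scaleR_right power2_eq_square
      by (simp only: inner_commute)
    moreover have "0 < v \<bullet> (A *v v)"
      using assms that by (simp add: posdef_def)
    ultimately show ?thesis
      by (metis add_pos_nonneg zero_le_power2)
  qed
  ultimately show ?thesis
    using assms by (simp add: posdef_def transpose_add)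
qed

text \<open>With \<open>A = \<Lambda>\<^sup>T \<Lambda>\<close> and \<open>b = \<Lambda>\<^sup>T b'\<close> one has \<open>A + b b\<^sup>T = \<Lambda>\<^sup>T (1 + b' b'\<^sup>T) \<Lambda>\<close>, so the determinant
  is multiplied by \<open>1 + |b'|\<^sup>2\<close>.\<close>

lemma det_add_outer:
  fixes A :: "real ^ 'm ^ 'm"
  assumes "posdef A"
  shows "det A \<le> det (A + outer b)" and "b \<noteq> 0 \<Longrightarrow> det A < det (A + outer b)"
proof -
  obtain \<Lambda> :: "real ^ 'm ^ 'm" where \<Lambda>: "invertible \<Lambda>" "A = transpose \<Lambda> ** \<Lambda>"
    by (rule posdef_factor[OF assms])
  have "invertible (transpose \<Lambda>)"
    using \<Lambda>(1) by (simp add: invertible_det_nz det_transpose)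
  then obtain M where M: "transpose \<Lambda> ** M = mat 1"
    by (auto simp: invertible_def)
  define b' where "b' = M *v b"
  have b: "b = transpose \<Lambda> *v b'"
    unfolding b'_def matrix_vector_mul_assoc M by simp
  have "A + outer b = transpose \<Lambda> ** (mat 1 + outer b') ** \<Lambda>"
    using outer_conjugate[of "transpose \<Lambda>" b']
    by (simp add: \<Lambda>(2) b matrix_add_ldistrib matrix_add_mult transpose_transpose)
  then have eq: "det (A + outer b) = det A * (1 + (norm b')\<^sup>2)"
    by (simp add: det_mul det_mat_1_plus_outer \<Lambda>(2))
  show "det A \<le> det (A + outer b)"
    using det_posdef_pos[OF assms] by (simp add: eq)
  assume "b \<noteq> 0"
  then have "b' \<noteq> 0"
    using b by auto
  then show "det A < det (A + outer b)"
    using det_posdef_pos[OF assms] by (simp add: eq)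
qed

lemma det_add_sum_outer:
  fixes b :: "'i \<Rightarrow> real ^ 'm"
  assumes "posdef A" "finite J"
  shows "posdef (A + (\<Sum>i\<in>J. outer (b i))) \<and> det A \<le> det (A + (\<Sum>i\<in>J. outer (b i))) \<and>
    ((\<exists>i\<in>J. b i \<noteq> 0) \<longrightarrow> det A < det (A + (\<Sum>i\<in>J. outer (b i))))"
  using assms(2)
proof induction
  case empty
  then show ?case using assms by simp
next
  case (insert j J)
  let ?A = "A + (\<Sum>i\<in>J. outer (b i))"
  have "A + (\<Sum>i\<in>insert j J. outer (b i)) = ?A + outer (b j)"
    using insert.hyps by (simp add: ac_simps)
  then show ?case
    using insert.IH posdef_add_outer[of ?A "b j"] det_add_outer[of ?A "b j"]
    by (smt (verit) insert_iff)
qed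

lemma matrix_diff_ldistrib:
  fixes A :: "'a::ring_1 ^ 'n ^ 'm"
  shows "A ** (B - C) = A ** B - A ** C"
  by (metis add_diff_cancel diff_add_cancel matrix_add_ldistrib)

lemma gram_eq_sum_outer:
  fixes N :: "real ^ 'm ^ 'n"
  shows "transpose N ** N = (\<Sum>i\<in>UNIV. outer (N $ i))"
  by (simp add: vec_eq_iff matrix_matrix_mult_def transpose_def outer_def)

text \<open>The matrix \<open>N\<^sup>T N\<close> is the sum of \<open>b b\<^sup>T\<close> over the rows \<open>b\<close> of \<open>N\<close>; each summand that is not \<open>0\<close>
  makes the determinant strictly larger.\<close>

lemma det_add_gram:
  fixes N :: "real ^ 'm ^ 'n"
  assumes "posdef A"
  shows "det A \<le> det (A + transpose N ** N)"
    and "det (A + transpose N ** N) = det A \<longleftrightarrow> N = 0"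
proof -
  have "N = 0 \<longleftrightarrow> (\<forall>i\<in>UNIV. N $ i = 0)"
    by (simp add: vec_eq_iff)
  then show "det A \<le> det (A + transpose N ** N)" "det (A + transpose N ** N) = det A \<longleftrightarrow> N = 0"
    using det_add_sum_outer[OF assms, of UNIV "\<lambda>i. N $ i"]
    unfolding gram_eq_sum_outer[symmetric] by auto
qed

lemma inner_gram_mult:
  fixes X :: "real ^ 'm ^ 'n"
  shows "u \<bullet> ((transpose X ** X) *v v) = (X *v u) \<bullet> (X *v v)"
  by (simp add: inner_matrix_mult flip: matrix_vector_mul_assoc del: transpose_matrix_vector)

lemma posdef_gram:
  fixes X :: "real ^ 'm ^ 'n"
  assumes "det (transpose X ** X) \<noteq> 0"
  shows "posdef (transpose X ** X)"
proof -
  have "X *v v \<noteq> 0" if "v \<noteq> 0" for v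
  proof
    assume "X *v v = 0"
    then have "(transpose X ** X) *v v = 0"
      by (simp flip: matrix_vector_mul_assoc)
    with assms that show False
      by (auto simp: det_eq_0_iff_kernel)
  qed
  then show ?thesis
    by (simp add: posdef_def inner_gram_mult matrix_transpose_mul transpose_transpose)
qed

lemma det_gram_nonneg:
  fixes X :: "real ^ 'm ^ 'n"
  shows "0 \<le> det (transpose X ** X)"
  by (metis det_posdef_pos posdef_gram less_eq_real_def)

text \<open>This is the Cauchy-Schwarz inequality for the simple \<open>m\<close>-vectors spanned by the columns
  of \<open>X\<close> and of \<open>Y\<close>. If \<open>det (X\<^sup>T Y) \<noteq> 0\<close>, split \<open>Y = X R + N\<close>, where the columns of \<open>N\<close> are orthogonal to those of \<open>X\<close>. Then
  \<open>X\<^sup>T Y = X\<^sup>T X R\<close> and \<open>Y\<^sup>T Y = (X R)\<^sup>T (X R) + N\<^sup>T N\<close>, and dropping \<open>N\<^sup>T N\<close> lowers the determinant unless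
  \<open>N = 0\<close>.\<close>

lemma det_Cauchy_Schwarz:
  fixes X Y :: "real ^ 'm ^ 'n"
  shows "(det (transpose X ** Y))\<^sup>2 \<le> det (transpose X ** X) * det (transpose Y ** Y)"
    and "det (transpose X ** Y) \<noteq> 0 \<Longrightarrow>
      (det (transpose X ** Y))\<^sup>2 = det (transpose X ** X) * det (transpose Y ** Y) \<longleftrightarrow>
      (\<exists>R. Y = X ** R)"
proof -
  have "(det (transpose X ** Y))\<^sup>2 \<le> det (transpose X ** X) * det (transpose Y ** Y) \<and>
    (det (transpose X ** Y) \<noteq> 0 \<longrightarrow>
      ((det (transpose X ** Y))\<^sup>2 = det (transpose X ** X) * det (transpose Y ** Y) \<longleftrightarrow>
      (\<exists>R. Y = X ** R)))"
  proof (cases "det (transpose X ** Y) = 0")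
    case True
    then show ?thesis
      by (simp add: det_gram_nonneg)
  next
    case False
    let ?A = "transpose X ** X"
    have "det ?A \<noteq> 0"
    proof
      assume "det ?A = 0"
      then obtain z where z: "z \<noteq> 0" "?A *v z = 0"
        by (auto simp: det_eq_0_iff_kernel)
      then have "(X *v z) \<bullet> (X *v z) = 0"
        by (metis inner_gram_mult inner_zero_right)
      then have "X *v z = 0"
        by simp
      then have "(transpose Y ** X) *v z = 0"
        by (simp flip: matrix_vector_mul_assoc)
      then have "det (transpose Y ** X) = 0"
        using z(1) by (auto simp: det_eq_0_iff_kernel)
      moreover have "det (transpose Y ** X) = det (transpose X ** Y)"
        by (metis det_transpose matrix_transpose_mul transpose_transpose)
      ultimately show False
        using False by simp
    qed
    then obtain A' where A': "?A ** A' = mat 1"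
      by (metis invertible_def invertible_det_nz)
    \<comment> \<open>The least-squares solution of \<open>X R = Y\<close>.\<close>
    define R where "R = A' ** (transpose X ** Y)"
    define N where "N = Y - X ** R"
    have AR: "?A ** R = transpose X ** Y"
      by (simp add: R_def matrix_mul_assoc A')
    have XN: "transpose X ** N = 0"
      by (simp add: N_def matrix_diff_ldistrib matrix_mul_assoc AR)
    have NX: "transpose N ** X = 0"
      using XN by (metis matrix_transpose_mul transpose_transpose transpose_iff transpose_zero)
    have Y: "Y = X ** R + N"
      by (simp add: N_def)
    let ?B = "transpose (X ** R) ** (X ** R)"
    have "transpose Y ** Y = ?B + transpose N ** N"
    proof -
      have "transpose (X ** R) ** N = transpose R ** (transpose X ** N)"
        by (simp add: matrix_transpose_mul matrix_mul_assoc)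
      moreover have "transpose N ** (X ** R) = 0"
        by (simp add: NX matrix_mul_assoc)
      ultimately show ?thesis
        by (simp add: Y XN transpose_add matrix_add_ldistrib matrix_add_mult)
    qed
    moreover have detB: "det ?B = det ?A * (det R)\<^sup>2"
    proof -
      have "?B = transpose R ** ?A ** R"
        by (simp add: matrix_transpose_mul matrix_mul_assoc)
      then show ?thesis
        by (simp add: det_mul power2_eq_square)
    qed
    moreover have detXY: "det (transpose X ** Y) = det ?A * det R"
      by (metis AR det_mul)
    moreover have B: "posdef ?B"
      using False detB detXY by (intro posdef_gram) auto
    moreover have A0: "0 < det ?A"
      using \<open>det ?A \<noteq> 0\<close> det_gram_nonneg[of X] by linarith
    moreover have "(det (transpose X ** Y))\<^sup>2 = det ?A * det ?B"
      unfolding detXY detB by (simp add: power2_eq_square)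
    ultimately have le: "(det (transpose X ** Y))\<^sup>2 \<le> det ?A * det (transpose Y ** Y)"
      and eq: "(det (transpose X ** Y))\<^sup>2 = det ?A * det (transpose Y ** Y) \<longleftrightarrow> N = 0"
      using det_add_gram[OF B, of N] by auto
    moreover have "N = 0 \<longleftrightarrow> (\<exists>R. Y = X ** R)"
    proof
      assume "\<exists>R. Y = X ** R"
      then obtain R' where "Y = X ** R'" ..
      then have "N = X ** (R' - R)"
        by (simp add: N_def matrix_diff_ldistrib)
      then have "transpose N ** N = 0"
        by (metis NX matrix_mul_assoc zero_matrix_mult)
      then show "N = 0"
        using det_add_gram(2)[OF B, of N] by simp
    qed (auto simp: Y)
    ultimately show ?thesis
      by blast
  qed
  then show "(det (transpose X ** Y))\<^sup>2 \<le> det (transpose X ** X) * det (transpose Y ** Y)"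
    and "det (transpose X ** Y) \<noteq> 0 \<Longrightarrow>
      (det (transpose X ** Y))\<^sup>2 = det (transpose X ** X) * det (transpose Y ** Y) \<longleftrightarrow>
      (\<exists>R. Y = X ** R)"
    by blast+
qed

lemma matrix_with_det:
  obtains R :: "real ^ 'm ^ 'm" where "det R = t"
proof -
  obtain k :: 'm where True by simp
  let ?R = "(\<chi> i j. if i = j then (if i = k then t else 1) else 0) :: real ^ 'm ^ 'm"
  have "det ?R = t"
    by (subst det_diagonal) simp_all
  then show thesis
    by (rule that)
qed

text \<open>The linear algebra of the theorem at one point: \<open>P\<close> and \<open>S\<close> are the derivatives of the
  projection and of the zero section, and \<open>G\<close> is the metric. Without a largest element \<open>GREATEST\<close> would
  denote an unknown number, which might happen to be \<open>1\<close>; hence the maximum is shown to be attained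
  before perpendicularity enters.\<close>

lemma max_pulled_back_volume_eq_1_iff:
  fixes G :: "real ^ 'n \<Rightarrow> real ^ 'n \<Rightarrow> real"
    and P :: "real ^ 'n \<Rightarrow> real ^ 'm" and S :: "real ^ 'm \<Rightarrow> real ^ 'n"
  assumes bil: "bilinear G" and sym: "\<And>u v. G u v = G v u" and pos: "\<And>v. v \<noteq> 0 \<Longrightarrow> 0 < G v v"
    and P: "linear P" and S: "linear S" and PS: "\<And>w. P (S w) = w"
  shows "(GREATEST r. \<exists>y :: 'm \<Rightarrow> real ^ 'n. sqrt (det (\<chi> i j. G (y i) (y j))) = 1 \<and>
       r = sqrt (det (\<chi> i j. G (S (axis i 1)) (S (axis j 1)))) * det (\<chi> i j. P (y j) $ i)) = 1 \<longleftrightarrow>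
    (\<forall>k w. P k = 0 \<longrightarrow> G k (S w) = 0)"
proof -
  obtain \<Lambda> :: "real ^ 'n ^ 'n" where inv: "invertible \<Lambda>" and G: "\<And>u v. G u v = (\<Lambda> *v u) \<bullet> (\<Lambda> *v v)"
    by (rule posdef_form_eq_inner[OF bil sym pos]) blast+
  obtain \<Lambda>' where \<Lambda>': "\<Lambda> ** \<Lambda>' = mat 1" "\<Lambda>' ** \<Lambda> = mat 1"
    using inv by (auto simp: invertible_def)
  have \<Lambda>'v: "\<Lambda> *v (\<Lambda>' *v v) = v" "\<Lambda>' *v (\<Lambda> *v v) = v" for v
    by (simp_all add: matrix_vector_mul_assoc \<Lambda>')
  \<comment> \<open>The matrices of \<open>S\<close> and \<open>P\<close> in orthonormal coordinates.\<close>
  define s where "s = \<Lambda> ** matrix S"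
  define p where "p = matrix P ** \<Lambda>'"
  define X where "X = transpose p"
  have s: "s *v w = \<Lambda> *v (S w)" for w
    by (simp add: s_def matrix_works S flip: matrix_vector_mul_assoc)
  have p: "p *v (\<Lambda> *v v) = P v" for v
    by (simp add: p_def matrix_works P \<Lambda>'v flip: matrix_vector_mul_assoc)
  have ps: "p ** s = mat 1"
    by (simp add: matrix_eq p s PS flip: matrix_vector_mul_assoc)
  have inner_X: "u \<bullet> (X *v z) = (p *v u) \<bullet> z" for u z
    using inner_matrix_mult[of u X z] by (simp only: X_def transpose_transpose)
  define mat_of :: "('m \<Rightarrow> real ^ 'n) \<Rightarrow> real ^ 'm ^ 'n" where "mat_of y = transpose (\<chi> j. \<Lambda> *v y j)" for y
  have gram: "(\<chi> i j. G (y i) (y j)) = transpose (mat_of y) ** mat_of y" for y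
    by (simp add: vec_eq_iff mat_of_def G matrix_matrix_mult_def inner_vec_def transpose_def)
  have PY: "(\<chi> i j. P (y j) $ i) = p ** mat_of y" for y
    by (simp add: vec_eq_iff mat_of_def matrix_matrix_mult_def transpose_def flip: p)
       (simp add: matrix_vector_mult_def)
  have "mat_of (\<lambda>i. S (axis i 1)) = s"
    by (simp add: mat_of_def vec_eq_iff transpose_def matrix_vector_mult_basis column_def flip: s)
  with gram[of "\<lambda>i. S (axis i 1)"]
  have gramS: "(\<chi> i j. G (S (axis i 1)) (S (axis j 1))) = transpose s ** s"
    by simp
  have mat_of_surj: "\<exists>y. mat_of y = Y" for Y
    by (rule exI[of _ "\<lambda>j. \<Lambda>' *v column j Y"]) (simp add: mat_of_def vec_eq_iff \<Lambda>'v transpose_def column_def)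
  let ?a = "det (transpose s ** s)" and ?b = "det (transpose X ** X)"
  have Xs: "transpose X ** s = mat 1"
    by (simp add: X_def ps)
  have ab: "1 \<le> ?a * ?b"
    using det_Cauchy_Schwarz(1)[of X s] by (simp add: Xs mult.commute)
  then have b: "0 < ?b"
    using det_gram_nonneg[of X] det_gram_nonneg[of s] by (cases "?b = 0") auto
  have greatest: "(GREATEST r. \<exists>y :: 'm \<Rightarrow> real ^ 'n. sqrt (det (\<chi> i j. G (y i) (y j))) = 1 \<and>
       r = sqrt (det (\<chi> i j. G (S (axis i 1)) (S (axis j 1)))) * det (\<chi> i j. P (y j) $ i)) =
       sqrt ?a * sqrt ?b"
  proof (rule Greatest_equality)
    \<comment> \<open>The maximum is attained on the columns of \<open>X\<close>, scaled to an \<open>m\<close>-vector of norm \<open>1\<close>.\<close>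
    obtain R :: "real ^ 'm ^ 'm" where R: "det R = 1 / sqrt ?b"
      by (rule matrix_with_det)
    obtain y where y: "mat_of y = X ** R"
      using mat_of_surj by blast
    have "transpose (mat_of y) ** mat_of y = transpose R ** (transpose X ** X) ** R"
      by (simp add: y matrix_transpose_mul matrix_mul_assoc)
    then have "det (transpose (mat_of y) ** mat_of y) = 1"
      using b by (simp add: det_mul R)
    moreover have "det (p ** mat_of y) = ?b * det R"
      by (simp add: y matrix_mul_assoc det_mul X_def)
    then have "det (p ** mat_of y) = sqrt ?b"
      using b by (simp add: R real_div_sqrt)
    ultimately show "\<exists>y :: 'm \<Rightarrow> real ^ 'n. sqrt (det (\<chi> i j. G (y i) (y j))) = 1 \<and>
       sqrt ?a * sqrt ?b = sqrt (det (\<chi> i j. G (S (axis i 1)) (S (axis j 1)))) * det (\<chi> i j. P (y j) $ i)"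
      unfolding gramS unfolding gram PY by (intro exI[of _ y]) simp
  next
    fix r
    assume "\<exists>y :: 'm \<Rightarrow> real ^ 'n. sqrt (det (\<chi> i j. G (y i) (y j))) = 1 \<and>
       r = sqrt (det (\<chi> i j. G (S (axis i 1)) (S (axis j 1)))) * det (\<chi> i j. P (y j) $ i)"
    then obtain y where y: "det (transpose (mat_of y) ** mat_of y) = 1"
      "r = sqrt ?a * det (transpose X ** mat_of y)"
      unfolding gramS unfolding gram PY X_def transpose_transpose by auto
    have "det (transpose X ** mat_of y) \<le> sqrt ?b"
      using det_Cauchy_Schwarz(1)[of X "mat_of y"] y(1) by (intro real_le_rsqrt) simp
    then show "r \<le> sqrt ?a * sqrt ?b"
      using det_gram_nonneg[of s] by (simp add: y(2) mult_left_mono)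
  qed
  have "sqrt ?a * sqrt ?b = 1 \<longleftrightarrow> (det (transpose X ** s))\<^sup>2 = ?b * ?a"
    by (simp add: Xs mult.commute flip: real_sqrt_mult)
  also have "\<dots> \<longleftrightarrow> (\<exists>R. s = X ** R)"
    by (rule det_Cauchy_Schwarz(2)) (simp add: Xs)
  also have "\<dots> \<longleftrightarrow> (\<forall>k w. P k = 0 \<longrightarrow> G k (S w) = 0)"
  proof
    assume "\<exists>R. s = X ** R"
    then obtain R where R: "s = X ** R" ..
    have "G k (S w) = P k \<bullet> (R *v w)" for k w
    proof -
      have "G k (S w) = (\<Lambda> *v k) \<bullet> (X *v (R *v w))"
        by (simp add: G R flip: s matrix_vector_mul_assoc)
      then show ?thesis
        by (simp only: inner_X p)
    qed
    then show "\<forall>k w. P k = 0 \<longrightarrow> G k (S w) = 0"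
      by simp
  next
    assume perp: "\<forall>k w. P k = 0 \<longrightarrow> G k (S w) = 0"
    obtain R where R: "transpose X ** X ** R = mat 1"
      using b by (metis invertible_def invertible_det_nz less_irrefl)
    have "s *v w = (X ** R) *v w" for w
    proof -
      \<comment> \<open>The component of \<open>S w\<close> orthogonal to the columns of \<open>X\<close> lies in \<open>ker P\<close>,
        so it is orthogonal both to \<open>S w\<close> and to the columns of \<open>X\<close>, hence to itself.\<close>
      define n where "n = s *v w - X *v (R *v w)"
      have pX: "p *v (X *v (R *v w)) = w"
      proof -
        have "(p ** X ** R) *v w = w"
          using R by (simp add: X_def)
        then show ?thesis
          by (simp flip: matrix_vector_mul_assoc)
      qed
      have pn: "p *v n = 0"
        by (simp add: n_def matrix_vector_mult_diff_distrib pX s p PS)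
      then have "P (\<Lambda>' *v n) = 0"
        by (simp add: \<Lambda>'v flip: p)
      then have "n \<bullet> (s *v w) = 0"
        using perp[rule_format, of "\<Lambda>' *v n" w] by (simp add: G \<Lambda>'v s)
      moreover have "n \<bullet> (X *v (R *v w)) = 0"
        using pn by (simp add: inner_X)
      ultimately have "n \<bullet> n = 0"
        by (subst (2) n_def) (simp add: inner_diff_right)
      then show ?thesis
        by (simp add: n_def matrix_vector_mul_assoc)
    qed
    then show "\<exists>R. s = X ** R"
      by (auto simp: matrix_eq)
  qed
  finally show ?thesis
    unfolding greatest .
qed

section \<open>Smooth functions along affine lines\<close>

lemma Ck_on_cong:
  assumes "open U" "\<And>x. x \<in> U \<Longrightarrow> f x = g x" "Ck_on k f U"
  shows "Ck_on k g U"
  using assms(2,3)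
proof (induction k arbitrary: f g)
  case 0
  then show ?case
    using continuous_on_cong[of U U f g] by simp
next
  case (Suc k)
  have D: "(g has_derivative frechet_derivative f (at x)) (at x)" if "x \<in> U" for x
    using Suc.prems(2) that
    by (intro has_derivative_transform_within_open[OF _ \<open>open U\<close> that Suc.prems(1)])
       (auto simp: frechet_derivative_works)
  then have "frechet_derivative f (at x) v = frechet_derivative g (at x) v" if "x \<in> U" for x v
    using frechet_derivative_at[OF D[OF that]] by simp
  then have "Ck_on k (\<lambda>x. frechet_derivative g (at x) v) U" for v
    by (rule Suc.IH[of "\<lambda>x. frechet_derivative f (at x) v"]) (use Suc.prems(2) in auto)
  moreover have "g differentiable (at x)" if "x \<in> U" for x
    using D[OF that] by (rule differentiableI)
  ultimately show ?case
    by (simp only: Ck_on.simps) blast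
qed

text \<open>The induction stays within functions of this shape, because the derivative of \<open>t \<mapsto> F (a + t w)\<close> in
  direction \<open>h\<close> is the restriction to the line of the directional derivative of \<open>F\<close> along \<open>h w\<close>.\<close>

lemma Ck_on_affine_line:
  fixes F :: "'v::euclidean_space \<Rightarrow> 'w::euclidean_space"
  assumes "open U" "Ck_on k F U"
  shows "Ck_on k (\<lambda>t. F (a + t *\<^sub>R w)) ((\<lambda>t. a + t *\<^sub>R w) -` U)"
  using assms(2)
proof (induction k arbitrary: F)
  case 0
  then show ?case
    by (auto intro!: continuous_on_compose2[of U F] continuous_intros)
next
  case (Suc k)
  let ?V = "(\<lambda>t. a + t *\<^sub>R w) -` U"
  have V: "open ?V"
    using assms(1) by (intro open_vimage continuous_intros)
  have D: "((\<lambda>t. F (a + t *\<^sub>R w)) has_derivative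
      (\<lambda>h. frechet_derivative F (at (a + t *\<^sub>R w)) (h *\<^sub>R w))) (at t)" if "t \<in> ?V" for t
  proof -
    have "((\<lambda>t. a + t *\<^sub>R w) has_derivative (\<lambda>h. 0 + h *\<^sub>R w)) (at t)"
      by (intro has_derivative_add has_derivative_const has_derivative_scaleR_left has_derivative_ident)
    then have "((\<lambda>t. a + t *\<^sub>R w) has_derivative (\<lambda>h. h *\<^sub>R w)) (at t)"
      by simp
    moreover have "(F has_derivative frechet_derivative F (at (a + t *\<^sub>R w))) (at (a + t *\<^sub>R w))"
      using that Suc.prems by (simp add: frechet_derivative_works)
    ultimately show ?thesis
      by (rule has_derivative_compose)
  qed
  have "Ck_on k (\<lambda>t. frechet_derivative (\<lambda>t. F (a + t *\<^sub>R w)) (at t) h) ?V" for h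
  proof (rule Ck_on_cong[OF V])
    show "Ck_on k (\<lambda>t. frechet_derivative F (at (a + t *\<^sub>R w)) (h *\<^sub>R w)) ?V"
      by (rule Suc.IH[of "\<lambda>y. frechet_derivative F (at y) (h *\<^sub>R w)"]) (use Suc.prems in auto)
    fix t assume "t \<in> ?V"
    from frechet_derivative_at[OF D[OF this]]
    show "frechet_derivative F (at (a + t *\<^sub>R w)) (h *\<^sub>R w) =
        frechet_derivative (\<lambda>t. F (a + t *\<^sub>R w)) (at t) h"
      by (rule fun_cong)
  qed
  moreover have "(\<lambda>t. F (a + t *\<^sub>R w)) differentiable (at t)" if "t \<in> ?V" for t
    using D[OF that] by (rule differentiableI)
  ultimately show ?case
    by (simp only: Ck_on.simps) blast
qed

lemma smooth_on_subset: "smooth_on S f \<Longrightarrow> T \<subseteq> S \<Longrightarrow> smooth_on T f"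
  unfolding smooth_on_def by (meson IntD1 IntD2 IntI subsetD)

lemma smooth_on_affine_line:
  assumes "smooth_on S f" "\<And>t. t \<in> T \<Longrightarrow> a + t *\<^sub>R w \<in> S"
  shows "smooth_on T (\<lambda>t. f (a + t *\<^sub>R w))"
  unfolding smooth_on_def
proof
  fix t assume "t \<in> T"
  then obtain U F where U: "open U" "a + t *\<^sub>R w \<in> U" "\<And>k. Ck_on k F U" "\<And>y. y \<in> U \<inter> S \<Longrightarrow> F y = f y"
    using assms unfolding smooth_on_def by meson
  let ?V = "(\<lambda>t. a + t *\<^sub>R w) -` U"
  have "open ?V"
    using U(1) by (intro open_vimage continuous_intros)
  moreover have "Ck_on k (\<lambda>t. F (a + t *\<^sub>R w)) ?V" for k
    using U by (blast intro: Ck_on_affine_line)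
  ultimately show "\<exists>U F. open U \<and> t \<in> U \<and> (\<forall>k. Ck_on k F U) \<and> (\<forall>y\<in>U \<inter> T. F y = f (a + y *\<^sub>R w))"
    using U assms(2) by (intro exI[of _ ?V] exI[of _ "\<lambda>t. F (a + t *\<^sub>R w)"]) auto
qed

lemma smooth_on_has_derivative:
  assumes "smooth_on S f" "x \<in> S"
  shows "\<exists>L. (f has_derivative L) (at x within S)"
proof -
  obtain U F where U: "open U" "x \<in> U" "\<And>k. Ck_on k F U" "\<And>y. y \<in> U \<inter> S \<Longrightarrow> F y = f y"
    using assms unfolding smooth_on_def by meson
  have "F differentiable (at x)"
    using U(3)[of "Suc 0"] U(2) by simp
  then obtain L where "(F has_derivative L) (at x)"
    by (auto simp: differentiable_def)
  then have "(F has_derivative L) (at x within S)"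
    by (rule has_derivative_at_withinI)
  then have "(f has_derivative L) (at x within S)"
    by (rule has_derivative_transform_eventually)
       (use U assms(2) in \<open>auto simp: eventually_at_topological intro!: exI[of _ U]\<close>)
  then show ?thesis
    by blast
qed

section \<open>Derivatives in charts\<close>

lemma smooth_map_subset: "smooth_map A B S f \<Longrightarrow> T \<subseteq> S \<Longrightarrow> smooth_map A B T f"
  unfolding smooth_map_def
  by (intro conjI ballI) (blast intro: continuous_on_subset, rule smooth_on_subset, blast+)

text \<open>The condition that an atlas imposes on each of its charts, stated for a single chart so that it
  applies also to the chart \<open>(UNIV, id)\<close> of the real line and to products of charts with a vector space.\<close>

definition regular_chart :: "('a::topological_space, 'v::euclidean_space) chart \<Rightarrow> bool" where
  "regular_chart c \<longleftrightarrow> open (fst c) \<and> homeomorphism (fst c) (snd c ` fst c) (snd c) (cinv c) \<and>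
     (open (snd c ` fst c) \<or>
      (\<exists>b\<in>Basis. openin (top_of_set {x. 0 \<le> x \<bullet> b}) (snd c ` fst c)))"

text \<open>The derivative is taken within the whole chart image, unlike in \<open>chart_deriv\<close>, where the
  domain is cut down to the points that \<open>f\<close> maps to the other chart. By \<open>at_within_chart_nhd\<close> the two
  agree for continuous \<open>f\<close>, and a domain that does not depend on \<open>f\<close> makes the chain rule easy to apply.\<close>

definition chart_has_deriv ::
  "('a, 'v::euclidean_space) chart \<Rightarrow> ('b, 'w::euclidean_space) chart \<Rightarrow> ('a \<Rightarrow> 'b) \<Rightarrow>
   'a \<Rightarrow> ('v \<Rightarrow> 'w) \<Rightarrow> bool" where
  "chart_has_deriv c c' f p L \<longleftrightarrow>
     (snd c' \<circ> f \<circ> cinv c has_derivative L) (at (snd c p) within snd c ` fst c)"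

lemma regular_chart_atlas: "smooth_atlas_bd A \<Longrightarrow> c \<in> A \<Longrightarrow> regular_chart c"
  by (simp add: smooth_atlas_bd_def regular_chart_def)

lemma regular_chart_open: "regular_chart c \<Longrightarrow> open (fst c)"
  by (simp add: regular_chart_def)

lemma cinv_chart: "regular_chart c \<Longrightarrow> p \<in> fst c \<Longrightarrow> cinv c (snd c p) = p"
  by (simp add: regular_chart_def homeomorphism_def)

lemma chart_image_openin:
  assumes "regular_chart c" "open W"
  shows "openin (top_of_set (snd c ` fst c)) (snd c ` (fst c \<inter> W))"
  using assms by (intro homeomorphism_imp_open_map[of "fst c" _ _ "cinv c"])
    (auto simp: regular_chart_def)

lemma at_within_chart_nhd:
  assumes "regular_chart c" "open W" "p \<in> fst c" "p \<in> W"
  shows "at (snd c p) within snd c ` (fst c \<inter> W) = at (snd c p) within snd c ` fst c"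
proof -
  obtain O' where O': "open O'" "snd c ` (fst c \<inter> W) = snd c ` fst c \<inter> O'"
    using chart_image_openin[OF assms(1,2)] by (auto simp: openin_open)
  show ?thesis
    using O' assms(3,4) by (intro at_within_nhd[of _ O']) auto
qed

text \<open>Chart images are relatively open in the whole space or in a half-space \<open>0 \<le> x \<bullet> b\<close>. Hence they
  contain, with a point, short segments from it in all coordinate directions, also at the boundary,
  and these determine a derivative.\<close>

lemma chart_has_deriv_unique:
  assumes "regular_chart c" "p \<in> fst c" "chart_has_deriv c c' f p L" "chart_has_deriv c c' f p L'"
  shows "L = L'"
proof (rule frechet_derivative_unique_within)
  show "(snd c' \<circ> f \<circ> cinv c has_derivative L) (at (snd c p) within snd c ` fst c)"
    "(snd c' \<circ> f \<circ> cinv c has_derivative L') (at (snd c p) within snd c ` fst c)"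
    using assms(3,4) by (simp_all add: chart_has_deriv_def)
  fix i :: 'b and e :: real
  assume i: "i \<in> Basis" and e: "0 < e"
  let ?y = "snd c p" and ?S = "snd c ` fst c"
  obtain O' where O': "open O'" "?y \<in> O'" and S: "?S = O' \<or> (\<exists>b\<in>Basis. ?S = {x. 0 \<le> x \<bullet> b} \<inter> O')"
    using assms(1,2) unfolding regular_chart_def openin_open by blast
  obtain r where r: "0 < r" "ball ?y r \<subseteq> O'"
    using O' by (meson openE)
  define d where "d = min r e / 2"
  have d: "0 < d" "d < e" "d < r"
    using r e by (auto simp: d_def)
  have "dist ?y (?y + d *\<^sub>R i) < r"
    using d i by (simp add: dist_norm)
  then have inO: "?y + d *\<^sub>R i \<in> O'"
    using r by auto
  have "?y \<in> ?S"
    using assms(2) by simp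
  have "?y + d *\<^sub>R i \<in> ?S"
    using S
  proof
    assume "\<exists>b\<in>Basis. ?S = {x. 0 \<le> x \<bullet> b} \<inter> O'"
    then obtain b where b: "b \<in> Basis" "?S = {x. 0 \<le> x \<bullet> b} \<inter> O'" by blast
    then have "0 \<le> ?y \<bullet> b"
      using \<open>?y \<in> ?S\<close> by blast
    moreover have "0 \<le> i \<bullet> b"
      using i b(1) by (simp add: inner_Basis)
    ultimately show ?thesis
      using d inO by (simp add: b(2) inner_add_left)
  qed (use inO in simp)
  with d show "\<exists>d. 0 < \<bar>d\<bar> \<and> \<bar>d\<bar> < e \<and> ?y + d *\<^sub>R i \<in> ?S"
    by (intro exI[of _ d]) simp
qed

lemma smooth_map_chart_has_deriv:
  assumes "smooth_map A B W f" "open W" "p \<in> W" "c \<in> A" "c' \<in> B" "regular_chart c" "open (fst c')"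
    "p \<in> fst c" "f p \<in> fst c'"
  shows "\<exists>L. chart_has_deriv c c' f p L"
proof -
  let ?V = "W \<inter> f -` fst c'"
  have "open ?V"
    using assms by (intro continuous_open_preimage) (auto simp: smooth_map_def)
  moreover have "fst c \<inter> W \<inter> f -` fst c' = fst c \<inter> ?V"
    by blast
  then have "smooth_on (snd c ` (fst c \<inter> ?V)) (snd c' \<circ> f \<circ> cinv c)"
    using assms(1,4,5) unfolding smooth_map_def by metis
  then have "\<exists>L. (snd c' \<circ> f \<circ> cinv c has_derivative L) (at (snd c p) within snd c ` (fst c \<inter> ?V))"
    using assms by (intro smooth_on_has_derivative) auto
  ultimately show ?thesis
    using at_within_chart_nhd[of c ?V p] assms by (auto simp: chart_has_deriv_def)
qed

lemma chart_has_deriv_chart_deriv: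
  assumes "smooth_map A B UNIV f" "c \<in> A" "c' \<in> B" "regular_chart c" "open (fst c')"
    "p \<in> fst c" "f p \<in> fst c'"
  shows "chart_has_deriv c c' f p (chart_deriv c c' f p)"
proof -
  have "open (f -` fst c')"
    using assms by (intro open_vimage) (auto simp: smooth_map_def)
  then have "at (snd c p) within snd c ` (fst c \<inter> f -` fst c') = at (snd c p) within snd c ` fst c"
    using assms by (intro at_within_chart_nhd) auto
  moreover obtain L where "chart_has_deriv c c' f p L"
    using smooth_map_chart_has_deriv[OF assms(1) open_UNIV UNIV_I assms(2-7)] by blast
  then have "snd c' \<circ> f \<circ> cinv c differentiable (at (snd c p) within snd c ` fst c)"
    by (auto simp: chart_has_deriv_def differentiable_def)
  ultimately show ?thesis
    by (simp add: chart_has_deriv_def chart_deriv_def frechet_derivative_works)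
qed

lemma chart_has_deriv_cong:
  assumes "chart_has_deriv c c' f p L" "regular_chart c" "open W" "p \<in> fst c" "p \<in> W"
    "\<And>q. q \<in> W \<Longrightarrow> f q = h q"
  shows "chart_has_deriv c c' h p L"
proof -
  have "(snd c' \<circ> f \<circ> cinv c has_derivative L) (at (snd c p) within snd c ` (fst c \<inter> W))"
    using assms(1) by (simp add: chart_has_deriv_def at_within_chart_nhd assms)
  then have "(snd c' \<circ> h \<circ> cinv c has_derivative L) (at (snd c p) within snd c ` (fst c \<inter> W))"
    by (rule has_derivative_transform[rotated 2]) (use assms cinv_chart[OF assms(2)] in auto)
  then show ?thesis
    by (simp add: chart_has_deriv_def at_within_chart_nhd assms)
qed

lemma chart_has_deriv_compose:
  assumes f: "chart_has_deriv c c' f p L" and h: "chart_has_deriv c' c'' h (f p) L'"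
    and "open W" "continuous_on W f" "p \<in> W"
    and c: "regular_chart c" "p \<in> fst c" and c': "regular_chart c'" "f p \<in> fst c'"
  shows "chart_has_deriv c c'' (h \<circ> f) p (L' \<circ> L)"
proof -
  let ?V = "W \<inter> f -` fst c'"
  have "open ?V"
    using assms by (intro continuous_open_preimage) (auto simp: regular_chart_open)
  then have at: "at (snd c p) within snd c ` (fst c \<inter> ?V) = at (snd c p) within snd c ` fst c"
    using assms by (intro at_within_chart_nhd) auto
  let ?f = "snd c' \<circ> f \<circ> cinv c" and ?h = "snd c'' \<circ> h \<circ> cinv c'" and ?S = "snd c ` (fst c \<inter> ?V)"
  have "(?f has_derivative L) (at (snd c p) within ?S)"
    using f by (simp add: chart_has_deriv_def at)
  moreover have "(?h has_derivative L') (at (?f (snd c p)) within ?f ` ?S)"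
  proof (rule has_derivative_subset)
    show "(?h has_derivative L') (at (?f (snd c p)) within snd c' ` fst c')"
      using h by (simp add: chart_has_deriv_def cinv_chart c)
    show "?f ` ?S \<subseteq> snd c' ` fst c'"
      using cinv_chart[OF c(1)] by auto
  qed
  ultimately have "(?h \<circ> ?f has_derivative L' \<circ> L) (at (snd c p) within ?S)"
    by (rule diff_chain_within)
  then have "(snd c'' \<circ> (h \<circ> f) \<circ> cinv c has_derivative L' \<circ> L) (at (snd c p) within ?S)"
    by (rule has_derivative_transform[rotated 2])
       (use c assms(5) c'(2) cinv_chart[OF c(1)] cinv_chart[OF c'(1)] in auto)
  then show ?thesis
    by (simp add: chart_has_deriv_def at)
qed

lemma chart_has_deriv_id:
  assumes "regular_chart c" "p \<in> fst c"
  shows "chart_has_deriv c c id p id"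
  unfolding chart_has_deriv_def
proof (rule has_derivative_transform)
  show "(id has_derivative id) (at (snd c p) within snd c ` fst c)"
    by (simp add: id_def)
qed (use assms cinv_chart[OF assms(1)] in auto)

lemma regular_chart_real: "regular_chart (UNIV :: real set, id)"
  by (simp add: regular_chart_def homeomorphism_def)

text \<open>Velocities of curves are derivatives of maps from the manifold \<open>real\<close>, so the lemmas
  on derivatives in charts cover curves as well.\<close>

lemma chart_has_deriv_real_iff:
  "chart_has_deriv (UNIV, id) c \<gamma> 0 (\<lambda>h. h *\<^sub>R u) \<longleftrightarrow> ((snd c \<circ> \<gamma>) has_vector_derivative u) (at (0::real))"
  by (simp add: chart_has_deriv_def has_vector_derivative_def inv_id)

lemma chart_has_deriv_linear: "chart_has_deriv c c' f p L \<Longrightarrow> linear L"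
  by (auto simp: chart_has_deriv_def dest: has_derivative_linear)

lemma velocity_image:
  assumes "((snd c \<circ> \<gamma>) has_vector_derivative u) (at (0::real))"
    and "chart_has_deriv c c' f (\<gamma> 0) L" "regular_chart c" "\<gamma> 0 \<in> fst c"
    and "0 < e" "continuous_on {-e<..<e} \<gamma>"
  shows "((snd c' \<circ> (f \<circ> \<gamma>)) has_vector_derivative L u) (at 0)"
proof -
  have "chart_has_deriv (UNIV, id) c' (f \<circ> \<gamma>) 0 (L \<circ> (\<lambda>h. h *\<^sub>R u))"
    using assms by (intro chart_has_deriv_compose[of _ c _ _ _ _ _ _ "{-e<..<e}"] regular_chart_real)
      (simp_all add: chart_has_deriv_real_iff)
  moreover have "L \<circ> (\<lambda>h. h *\<^sub>R u) = (\<lambda>h. h *\<^sub>R L u)"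
    using chart_has_deriv_linear[OF assms(2)] by (simp add: fun_eq_iff linear_cmul)
  ultimately show ?thesis
    by (simp add: chart_has_deriv_real_iff)
qed

text \<open>Every vector \<open>L w\<close> in the image of the derivative of \<open>f\<close> is the velocity of a smooth curve, namely
  of the image under \<open>f\<close> of the affine line in direction \<open>w\<close> in a chart.\<close>

lemma coordinate_line:
  assumes f: "smooth_map B A W f" and W: "open W" and e: "e \<in> B" "regular_chart e" "open (snd e ` fst e)"
    and q: "q \<in> fst e" "q \<in> W" and L: "chart_has_deriv e c f q L"
  obtains \<epsilon> where "0 < \<epsilon>"
    "\<And>t. t \<in> {-\<epsilon><..<\<epsilon>} \<Longrightarrow> snd e q + t *\<^sub>R w \<in> snd e ` (fst e \<inter> W)"
    "smooth_map real_atlas A {-\<epsilon><..<\<epsilon>} (\<lambda>t. f (cinv e (snd e q + t *\<^sub>R w)))"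
    "((snd c \<circ> (\<lambda>t. f (cinv e (snd e q + t *\<^sub>R w)))) has_vector_derivative L w) (at 0)"
proof -
  let ?l = "\<lambda>t. snd e q + t *\<^sub>R w" and ?S = "snd e ` (fst e \<inter> W)"
  have "open ?S"
    using chart_image_openin[OF e(2) W] e(3) by (simp add: openin_open_eq)
  then have "open (?l -` ?S)"
    by (intro open_vimage continuous_intros)
  moreover have "0 \<in> ?l -` ?S"
    using q by auto
  ultimately obtain \<epsilon> where \<epsilon>: "0 < \<epsilon>" "ball 0 \<epsilon> \<subseteq> ?l -` ?S"
    by (meson openE)
  let ?I = "{-\<epsilon><..<\<epsilon>}"
  have l: "?l t \<in> ?S" if "t \<in> ?I" for t
    using \<epsilon>(2) that by (auto simp: dist_real_def abs_less_iff subset_iff)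
  have cinv_l: "cinv e (?l t) \<in> fst e \<inter> W" if "t \<in> ?I" for t
    using l[OF that] cinv_chart[OF e(2)] by auto
  have cont_l: "continuous_on ?I (\<lambda>t. cinv e (?l t))"
  proof (rule continuous_on_compose2[of "snd e ` fst e" "cinv e" ?I ?l])
    show "continuous_on (snd e ` fst e) (cinv e)"
      using e(2) by (simp add: regular_chart_def homeomorphism_def)
    show "continuous_on ?I ?l"
      by (intro continuous_intros)
    show "?l ` ?I \<subseteq> snd e ` fst e"
      using l by blast
  qed
  have "smooth_map real_atlas A ?I (\<lambda>t. f (cinv e (?l t)))"
    unfolding smooth_map_def
  proof (intro conjI ballI)
    show "continuous_on ?I (\<lambda>t. f (cinv e (?l t)))"
    proof (rule continuous_on_compose2[of W f ?I "\<lambda>t. cinv e (?l t)"])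
      show "continuous_on W f"
        using f by (simp add: smooth_map_def)
    qed (use cont_l cinv_l in auto)
    fix r :: "(real, real) chart" and c'
    assume "r \<in> real_atlas" and c': "c' \<in> A"
    then have r: "r = (UNIV, id)"
      by (simp add: real_atlas_def)
    let ?T = "snd r ` (fst r \<inter> ?I \<inter> (\<lambda>t. f (cinv e (?l t))) -` fst c')"
    have "smooth_on ?T (\<lambda>t. (snd c' \<circ> f \<circ> cinv e) (?l t))"
    proof (rule smooth_on_affine_line)
      show "smooth_on (snd e ` (fst e \<inter> W \<inter> f -` fst c')) (snd c' \<circ> f \<circ> cinv e)"
        using f e(1) c' by (simp add: smooth_map_def)
      fix t assume "t \<in> ?T"
      then have t: "t \<in> ?I" "f (cinv e (?l t)) \<in> fst c'"
        by (auto simp: r)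
      obtain z where z: "z \<in> fst e \<inter> W" "?l t = snd e z"
        using l[OF t(1)] by blast
      then show "?l t \<in> snd e ` (fst e \<inter> W \<inter> f -` fst c')"
        using t(2) cinv_chart[OF e(2), of z] by auto
    qed
    then show "smooth_on ?T (snd c' \<circ> (\<lambda>t. f (cinv e (?l t))) \<circ> cinv r)"
      by (simp add: r inv_id o_def)
  qed
  moreover have "((snd c \<circ> (f \<circ> (\<lambda>t. cinv e (?l t)))) has_vector_derivative L w) (at 0)"
  proof (rule velocity_image[where c = e and u = w and e = \<epsilon>])
    have "(?l has_vector_derivative w) (at 0)"
      by (auto intro!: derivative_eq_intros simp: has_vector_derivative_def)
    then show "((snd e \<circ> (\<lambda>t. cinv e (?l t))) has_vector_derivative w) (at 0)"
    proof (rule has_vector_derivative_transform_within_open)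
      show "open ?I" "0 \<in> ?I"
        using \<epsilon>(1) by auto
      fix t assume "t \<in> ?I"
      then have "?l t \<in> snd e ` fst e"
        using l by auto
      then show "?l t = (snd e \<circ> (\<lambda>t. cinv e (?l t))) t"
        by (simp add: f_inv_into_f)
    qed
  qed (use \<epsilon> cont_l L e q cinv_chart[OF e(2) q(1)] in auto)
  ultimately show thesis
    using \<epsilon>(1) l by (intro that[of \<epsilon>]) (auto simp: o_def)
qed

lemma regular_chart_times_vec:
  fixes c :: "('a::topological_space, 'v::euclidean_space) chart"
  assumes "regular_chart c" "open (snd c ` fst c)"
  shows "regular_chart (fst c \<times> (UNIV :: 'w::euclidean_space set), map_prod (snd c) id)"
    and "open (map_prod (snd c) (id :: 'w \<Rightarrow> 'w) ` (fst c \<times> UNIV))"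
proof -
  let ?e = "(fst c \<times> (UNIV :: 'w set), map_prod (snd c) (id :: 'w \<Rightarrow> 'w))"
  have h: "homeomorphism (fst c) (snd c ` fst c) (snd c) (cinv c)"
    using assms by (simp add: regular_chart_def)
  then have inj: "inj_on (snd e) (fst e)" if "e = c" for e
    using that by (metis homeomorphism_def inj_on_inverseI)
  have inj_e: "inj_on (snd ?e) (fst ?e)"
    using inj[OF refl] by (auto simp: inj_on_def)
  have img: "snd ?e ` fst ?e = (snd c ` fst c) \<times> UNIV"
    by force
  show op: "open (map_prod (snd c) (id :: 'w \<Rightarrow> 'w) ` (fst c \<times> UNIV))"
    using img assms(2) by (simp add: open_Times)
  have cinv_e: "cinv ?e z = (cinv c (fst z), snd z)" if "z \<in> snd ?e ` fst ?e" for z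
    using that inj_e inj[OF refl] by (auto simp: inv_into_f_f intro!: inv_into_f_eq)
  have "continuous_on (fst c) (snd c)" "continuous_on (snd c ` fst c) (cinv c)"
    using h by (auto simp: homeomorphism_def)
  note cont = this
  have "continuous_on (fst ?e) (\<lambda>z. (snd c (fst z), snd z))"
    by (auto intro!: continuous_intros continuous_on_compose2[OF cont(1)])
  then have 1: "continuous_on (fst ?e) (snd ?e)"
    by (simp add: map_prod_def case_prod_beta)
  have "continuous_on (snd ?e ` fst ?e) (\<lambda>z. (cinv c (fst z), snd z))"
    unfolding img by (auto intro!: continuous_intros continuous_on_compose2[OF cont(2)])
  then have 2: "continuous_on (snd ?e ` fst ?e) (cinv ?e)"
    by (rule continuous_on_eq) (simp only: cinv_e)
  have "homeomorphism (fst ?e) (snd ?e ` fst ?e) (snd ?e) (cinv ?e)"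
    using 1 2 inj_e by (intro homeomorphismI) (auto simp: inv_into_f_f f_inv_into_f)
  moreover have "open (fst ?e)"
    using assms(1) by (simp add: regular_chart_def open_Times)
  ultimately show "regular_chart ?e"
    using op by (simp add: regular_chart_def)
qed

section \<open>Tangent vectors in a chart\<close>

lemma smooth_map_id:
  assumes "smooth_atlas_bd A" shows "smooth_map A A UNIV id"
proof -
  have "smooth_on (snd c ` (fst c \<inter> fst c')) (snd c' \<circ> cinv c)" if "c \<in> A" "c' \<in> A" for c c'
    using assms that unfolding smooth_atlas_bd_def by blast
  then show ?thesis
    by (simp add: smooth_map_def)
qed

context
  fixes A :: "('a::{t2_space,second_countable_topology}, 'v::euclidean_space) chart set"
  assumes A: "smooth_atlas_bd A"
begin

lemma charts_at_iff: "c \<in> charts_at A p \<longleftrightarrow> c \<in> A \<and> p \<in> fst c"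
  by (auto simp: charts_at_def)

lemma charts_at_regular: "c \<in> charts_at A p \<Longrightarrow> regular_chart c"
  using A regular_chart_atlas unfolding charts_at_def by blast

lemma some_chart_at: "(SOME c. c \<in> charts_at A p) \<in> charts_at A p"
proof -
  have "(\<Union>c\<in>A. fst c) = UNIV"
    using A by (simp add: smooth_atlas_bd_def)
  then have "p \<in> (\<Union>c\<in>A. fst c)"
    by simp
  then obtain c where "c \<in> charts_at A p"
    unfolding charts_at_def by blast
  then show ?thesis
    by (rule someI)
qed

lemma transition_has_deriv:
  assumes "c \<in> charts_at A p" "c' \<in> charts_at A p"
  shows "chart_has_deriv c c' id p (chart_deriv c c' id p)"
  using assms charts_at_regular[OF assms(1)] regular_chart_open[OF charts_at_regular[OF assms(2)]]
  by (intro chart_has_deriv_chart_deriv[OF smooth_map_id[OF A]]) (auto simp: charts_at_iff)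

lemma transition_linear:
  "c \<in> charts_at A p \<Longrightarrow> c' \<in> charts_at A p \<Longrightarrow> linear (chart_deriv c c' id p)"
  by (rule chart_has_deriv_linear[OF transition_has_deriv])

lemma transition_self:
  assumes "c \<in> charts_at A p"
  shows "chart_deriv c c id p u = u"
  using chart_has_deriv_unique[OF charts_at_regular[OF assms] _ transition_has_deriv[OF assms assms]
      chart_has_deriv_id[OF charts_at_regular[OF assms]]] assms
  by (simp add: charts_at_iff)

lemma transition_compose:
  assumes "c \<in> charts_at A p" "c' \<in> charts_at A p" "c'' \<in> charts_at A p"
  shows "chart_deriv c' c'' id p (chart_deriv c c' id p u) = chart_deriv c c'' id p u"
proof -
  have "chart_has_deriv c c'' (id \<circ> id) p (chart_deriv c' c'' id p \<circ> chart_deriv c c' id p)"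
    using assms charts_at_regular[OF assms(1)] charts_at_regular[OF assms(2)]
      transition_has_deriv[OF assms(1,2)] transition_has_deriv[OF assms(2,3)]
    by (intro chart_has_deriv_compose[of _ c' _ _ _ _ _ _ UNIV]) (simp_all add: charts_at_iff)
  then have "chart_deriv c' c'' id p \<circ> chart_deriv c c' id p = chart_deriv c c'' id p"
    using assms charts_at_regular[OF assms(1)] transition_has_deriv[OF assms(1,3)]
    by (intro chart_has_deriv_unique[of c p c'' id]) (simp_all add: charts_at_iff)
  then show ?thesis
    by (simp add: fun_eq_iff)
qed

text \<open>The definition of tangent spaces writes \<open>v c'\<close> in terms of \<open>v c\<close>, which makes it a looping rewrite
  rule. Here it has the terminating orientation.\<close>

lemma tangent_space_transition:
  assumes "v \<in> tangent_space A p" "c \<in> charts_at A p" "c' \<in> charts_at A p"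
  shows "chart_deriv c c' id p (v c) = v c'"
proof -
  have "\<forall>c\<in>charts_at A p. \<forall>c'\<in>charts_at A p. v c' = chart_deriv c c' id p (v c)"
    using assms(1) unfolding tangent_space_def by blast
  from this[rule_format, OF assms(2,3)] show ?thesis
    by (rule sym)
qed

lemma tangent_space_no_chart:
  "v \<in> tangent_space A p \<Longrightarrow> c \<notin> charts_at A p \<Longrightarrow> v c = 0"
  unfolding tangent_space_def by blast

lemma tangent_spaceI:
  assumes "\<And>c. c \<notin> charts_at A p \<Longrightarrow> v c = 0"
    and "\<And>c c'. c \<in> charts_at A p \<Longrightarrow> c' \<in> charts_at A p \<Longrightarrow> chart_deriv c c' id p (v c) = v c'"
  shows "v \<in> tangent_space A p"
  unfolding tangent_space_def mem_Collect_eq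
  by (intro conjI allI impI ballI assms(1) assms(2)[symmetric])

lemma chart_vec_tangent: "c \<in> charts_at A p \<Longrightarrow> chart_vec A p c u \<in> tangent_space A p"
  by (rule tangent_spaceI) (simp_all add: chart_vec_def transition_compose)

lemma chart_vec_coord: "c \<in> charts_at A p \<Longrightarrow> chart_vec A p c u c = u"
  by (simp add: chart_vec_def transition_self)

text \<open>Together with \<open>chart_vec_coord\<close> this identifies the tangent space with the coordinate space of any
  chart around the point.\<close>

lemma chart_vec_of_coord:
  assumes "c \<in> charts_at A p" "v \<in> tangent_space A p"
  shows "chart_vec A p c (v c) = v"
proof
  fix c'
  show "chart_vec A p c (v c) c' = v c'"
    using tangent_space_transition[OF assms(2,1)] tangent_space_no_chart[OF assms(2)]
    by (simp add: chart_vec_def)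
qed

lemma chart_vec_linear:
  assumes "c \<in> charts_at A p"
  shows "chart_vec A p c (a *\<^sub>R u + b *\<^sub>R w) = tcomb a (chart_vec A p c u) b (chart_vec A p c w)"
  using transition_linear[OF assms]
  by (simp add: chart_vec_def tcomb_def fun_eq_iff linear_add linear_cmul)

text \<open>For a curve to have velocity \<open>v\<close> it suffices to check one chart.\<close>

lemma velocity_all_charts:
  assumes "v \<in> tangent_space A (\<gamma> 0)" "c \<in> charts_at A (\<gamma> 0)" "c' \<in> charts_at A (\<gamma> 0)"
    and "((snd c \<circ> \<gamma>) has_vector_derivative v c) (at 0)"
    and "0 < e" "continuous_on {-e<..<e} \<gamma>"
  shows "((snd c' \<circ> \<gamma>) has_vector_derivative v c') (at 0)"
proof -
  have "((snd c' \<circ> (id \<circ> \<gamma>)) has_vector_derivative chart_deriv c c' id (\<gamma> 0) (v c)) (at 0)"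
    using assms(2)
    by (intro velocity_image[OF assms(4) transition_has_deriv[OF assms(2,3)]
        charts_at_regular[OF assms(2)] _ assms(5,6)]) (simp add: charts_at_iff)
  then show ?thesis
    by (simp add: tangent_space_transition[OF assms(1-3)])
qed

lemma metric_in_chart:
  assumes g: "riemannian_metric A g" and c: "c \<in> charts_at A p"
  defines "G \<equiv> \<lambda>u w. g p (chart_vec A p c u) (chart_vec A p c w)"
  shows "bilinear G" "\<And>u w. G u w = G w u" "\<And>u. u \<noteq> 0 \<Longrightarrow> 0 < G u u"
proof -
  note T = chart_vec_tangent[OF c]
  have g_sym: "g p v w = g p w v"
    and g_lin: "u \<in> tangent_space A p \<Longrightarrow> g p (tcomb a u b v) w = a * g p u w + b * g p v w"
    and g_pos: "v \<noteq> (\<lambda>_. 0) \<Longrightarrow> 0 < g p v v"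
    if "v \<in> tangent_space A p" "w \<in> tangent_space A p" for a b u v w
    using g that unfolding riemannian_metric_def by blast+
  show sym: "G u w = G w u" for u w
    unfolding G_def by (rule g_sym[OF T T])
  have lin: "G (a *\<^sub>R u + b *\<^sub>R u') w = a * G u w + b * G u' w" for a u b u' w
    unfolding G_def chart_vec_linear[OF c] by (rule g_lin[OF T T T])
  have "linear (\<lambda>u. G u w)" for w
  proof (rule linearI)
    fix u u' and a :: real
    show "G (u + u') w = G u w + G u' w"
      using lin[of 1 u 1 u' w] by simp
    show "G (a *\<^sub>R u) w = a *\<^sub>R G u w"
      using lin[of a u 0 0 w] by simp
  qed
  moreover have "G u = (\<lambda>w. G w u)" for u
    by (rule ext) (rule sym)
  ultimately show "bilinear G"
    unfolding bilinear_def by metis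
  fix u :: 'v assume "u \<noteq> 0"
  then have "chart_vec A p c u \<noteq> (\<lambda>_. 0)"
    using chart_vec_coord[OF c, of u] by auto
  then show "0 < G u u"
    unfolding G_def by (rule g_pos[OF T T])
qed

end

text \<open>The chain rule for a change of the chart in the target.\<close>

lemma chart_deriv_change:
  assumes A: "smooth_atlas_bd A" and B: "smooth_atlas_bd B" and f: "smooth_map A B UNIV f"
    and c: "c \<in> charts_at A p" and d: "d \<in> charts_at B (f p)" "d' \<in> charts_at B (f p)"
  shows "chart_deriv c d' f p u = chart_deriv d d' id (f p) (chart_deriv c d f p u)"
proof -
  have cd: "chart_has_deriv c d'' f p (chart_deriv c d'' f p)" if "d'' \<in> charts_at B (f p)" for d''
    using c that charts_at_regular[OF A c] regular_chart_open[OF charts_at_regular[OF B that]]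
    by (intro chart_has_deriv_chart_deriv[OF f]) (simp_all add: charts_at_def)
  have "chart_has_deriv c d' (id \<circ> f) p (chart_deriv d d' id (f p) \<circ> chart_deriv c d f p)"
    using c d f
    by (intro chart_has_deriv_compose[OF cd[OF d(1)] transition_has_deriv[OF B d] open_UNIV]
        charts_at_regular[OF A c] charts_at_regular[OF B d(1)])
      (simp_all add: charts_at_def smooth_map_def)
  then have "chart_deriv d d' id (f p) \<circ> chart_deriv c d f p = chart_deriv c d' f p"
    using cd[OF d(2)] c
    by (intro chart_has_deriv_unique[OF charts_at_regular[OF A c], of p d' f])
      (simp_all add: charts_at_def)
  then show ?thesis
    by (simp add: fun_eq_iff)
qed

section \<open>Tangent spaces of the fibre and of the zero section\<close>

text \<open>Membership with the velocity condition reduced to a single chart.\<close>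

lemma submanifold_tangent_spaceI:
  assumes A: "smooth_atlas_bd A" and v: "v \<in> tangent_space A p" and c: "c \<in> charts_at A p"
    and \<gamma>: "0 < e" "smooth_map real_atlas A {-e<..<e} \<gamma>" "\<gamma> ` {-e<..<e} \<subseteq> S" "\<gamma> 0 = p"
    and vel: "((snd c \<circ> \<gamma>) has_vector_derivative v c) (at 0)"
  shows "v \<in> submanifold_tangent_space A S p"
proof -
  have "continuous_on {-e<..<e} \<gamma>"
    using \<gamma>(2) by (simp add: smooth_map_def)
  then have "\<forall>c'\<in>charts_at A p. ((snd c' \<circ> \<gamma>) has_vector_derivative v c') (at 0)"
    using velocity_all_charts[OF A, of v \<gamma> c _ e] v c vel \<gamma>(1,4) by simp
  then show ?thesis
    using v \<gamma> unfolding submanifold_tangent_space_def by blast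
qed

lemma submanifold_tangent_spaceE:
  assumes "v \<in> submanifold_tangent_space A S p" "c \<in> charts_at A p"
  obtains e \<gamma> where "v \<in> tangent_space A p" "0 < e" "continuous_on {-e<..<e} \<gamma>"
    "\<And>t. t \<in> {-e<..<e} \<Longrightarrow> \<gamma> t \<in> S" "\<gamma> 0 = p"
    "((snd c \<circ> \<gamma>) has_vector_derivative v c) (at 0)"
proof -
  from assms(1) obtain e \<gamma> where *: "v \<in> tangent_space A p" "0 < e" "smooth_map real_atlas A {-e<..<e} \<gamma>"
    "\<gamma> ` {-e<..<e} \<subseteq> S" "\<gamma> 0 = p" "\<forall>c\<in>charts_at A p. ((snd c \<circ> \<gamma>) has_vector_derivative v c) (at 0)"
    unfolding submanifold_tangent_space_def by blast
  have "continuous_on {-e<..<e} \<gamma>"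
    using *(3) by (simp add: smooth_map_def)
  then show thesis
    using * assms(2) by (intro that[of e \<gamma>]) blast+
qed

context
  fixes EA :: "('e::{t2_space,second_countable_topology}, real ^ 'n) chart set"
    and MA :: "('b::{t2_space,second_countable_topology}, real ^ 'm) chart set"
    and D :: "(real ^ 'k) set"
    and \<pi> :: "'e \<Rightarrow> 'b" and \<sigma> :: "'b \<Rightarrow> 'e"
  assumes disc: "disc_bundle EA MA D \<pi> \<sigma>"
begin

lemma total_atlas: "smooth_atlas_bd EA" and base_atlas: "smooth_atlas_bd MA"
  using disc by (simp_all add: disc_bundle_def smooth_atlas_def)

lemma smooth_projection: "smooth_map EA MA UNIV \<pi>" and smooth_section: "smooth_map MA EA UNIV \<sigma>"
  and projection_section: "\<pi> (\<sigma> y) = y"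
  using disc by (simp_all add: disc_bundle_def)

lemma continuous_projection: "continuous_on S \<pi>" and continuous_section: "continuous_on T \<sigma>"
  using smooth_projection smooth_section continuous_on_subset[of UNIV] by (auto simp: smooth_map_def)

context
  fixes x :: 'b and c :: "('e, real ^ 'n) chart" and d :: "('b, real ^ 'm) chart"
  assumes c: "c \<in> charts_at EA (\<sigma> x)" and d: "d \<in> charts_at MA x"
begin

lemma total_chart: "c \<in> EA" "\<sigma> x \<in> fst c" "regular_chart c" "open (fst c)"
  using c charts_at_regular[OF total_atlas c] regular_chart_open[OF charts_at_regular[OF total_atlas c]]
  by (simp_all add: charts_at_def)

lemma base_chart: "d \<in> MA" "x \<in> fst d" "regular_chart d" "open (fst d)" "open (snd d ` fst d)"
proof -
  show "d \<in> MA" "x \<in> fst d"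
    using d by (auto simp: charts_at_def)
  then show "open (snd d ` fst d)"
    using disc unfolding disc_bundle_def smooth_atlas_def by blast
  show "regular_chart d"
    by (rule charts_at_regular[OF base_atlas d])
  then show "open (fst d)"
    by (rule regular_chart_open)
qed

abbreviation (input) "P \<equiv> chart_deriv c d \<pi> (\<sigma> x)"
abbreviation (input) "S \<equiv> chart_deriv d c \<sigma> x"

lemma projection_has_deriv: "chart_has_deriv c d \<pi> (\<sigma> x) P"
  by (rule chart_has_deriv_chart_deriv[OF smooth_projection]) (simp_all add: total_chart base_chart projection_section)

lemma section_has_deriv: "chart_has_deriv d c \<sigma> x S"
  by (rule chart_has_deriv_chart_deriv[OF smooth_section]) (simp_all add: total_chart base_chart)

text \<open>Differentiate \<open>\<pi> \<circ> \<sigma> = id\<close>.\<close>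

lemma projection_section_deriv: "P (S w) = w"
proof -
  have "chart_has_deriv d d (\<pi> \<circ> \<sigma>) x (P \<circ> S)"
    by (rule chart_has_deriv_compose[OF section_has_deriv projection_has_deriv open_UNIV])
      (simp_all add: total_chart base_chart continuous_section)
  moreover have "\<pi> \<circ> \<sigma> = id"
    by (simp add: fun_eq_iff projection_section)
  ultimately have "P \<circ> S = id"
    using chart_has_deriv_unique[OF base_chart(3,2) _ chart_has_deriv_id[OF base_chart(3,2)]] by simp
  then show ?thesis
    by (simp add: fun_eq_iff)
qed

text \<open>A curve \<open>\<gamma>\<close> in the zero section satisfies \<open>\<gamma> = \<sigma> \<circ> \<pi> \<circ> \<gamma>\<close>, so its velocity \<open>v\<close> is \<open>S (P v)\<close>.
  Conversely, \<open>S w\<close> is the velocity of the image under \<open>\<sigma>\<close> of a line in direction \<open>w\<close>.\<close>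

lemma zero_section_tangent_space:
  "submanifold_tangent_space EA (range \<sigma>) (\<sigma> x) = {v \<in> tangent_space EA (\<sigma> x). \<exists>w. v c = S w}"
proof (intro equalityI subsetI)
  fix v assume "v \<in> submanifold_tangent_space EA (range \<sigma>) (\<sigma> x)"
  then obtain e \<gamma> where v: "v \<in> tangent_space EA (\<sigma> x)" and e: "0 < e"
    and \<gamma>: "continuous_on {-e<..<e} \<gamma>" "\<And>t. t \<in> {-e<..<e} \<Longrightarrow> \<gamma> t \<in> range \<sigma>" "\<gamma> 0 = \<sigma> x"
    and vel: "((snd c \<circ> \<gamma>) has_vector_derivative v c) (at 0)"
    using c by (rule submanifold_tangent_spaceE) blast
  have vel_\<pi>: "((snd d \<circ> (\<pi> \<circ> \<gamma>)) has_vector_derivative P (v c)) (at 0)"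
    by (rule velocity_image[OF vel _ total_chart(3) _ e \<gamma>(1)])
      (simp_all add: \<gamma>(3) projection_has_deriv total_chart)
  have cont_\<pi>: "continuous_on {-e<..<e} (\<pi> \<circ> \<gamma>)"
    by (intro continuous_on_compose \<gamma>(1) continuous_projection)
  have "((snd c \<circ> (\<sigma> \<circ> (\<pi> \<circ> \<gamma>))) has_vector_derivative S (P (v c))) (at 0)"
    by (rule velocity_image[OF vel_\<pi> _ base_chart(3) _ e cont_\<pi>])
      (simp_all add: \<gamma>(3) projection_section section_has_deriv base_chart)
  then have "((snd c \<circ> \<gamma>) has_vector_derivative S (P (v c))) (at 0)"
  proof (rule has_vector_derivative_transform_within_open)
    show "open {-e<..<e}" "0 \<in> {-e<..<e}"
      using e by auto
    fix t assume "t \<in> {-e<..<e}"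
    then show "(snd c \<circ> (\<sigma> \<circ> (\<pi> \<circ> \<gamma>))) t = (snd c \<circ> \<gamma>) t"
      using \<gamma>(2)[of t] by (auto simp: projection_section)
  qed
  then have "v c = S (P (v c))"
    using vel by (rule vector_derivative_unique_at[rotated])
  with v show "v \<in> {v \<in> tangent_space EA (\<sigma> x). \<exists>w. v c = S w}"
    by blast
next
  fix v assume "v \<in> {v \<in> tangent_space EA (\<sigma> x). \<exists>w. v c = S w}"
  then obtain w where v: "v \<in> tangent_space EA (\<sigma> x)" and w: "v c = S w"
    by blast
  obtain \<epsilon> where "0 < \<epsilon>"
    "smooth_map real_atlas EA {-\<epsilon><..<\<epsilon>} (\<lambda>t. \<sigma> (cinv d (snd d x + t *\<^sub>R w)))"
    "((snd c \<circ> (\<lambda>t. \<sigma> (cinv d (snd d x + t *\<^sub>R w)))) has_vector_derivative S w) (at 0)"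
    using coordinate_line[OF smooth_section open_UNIV base_chart(1,3,5,2) UNIV_I section_has_deriv, of w]
    by blast
  then show "v \<in> submanifold_tangent_space EA (range \<sigma>) (\<sigma> x)"
    using cinv_chart[OF base_chart(3,2)]
    by (intro submanifold_tangent_spaceI[OF total_atlas v c]) (auto simp: w)
qed

text \<open>The projection is constant along a curve in the fibre.\<close>

lemma fibre_tangent_subset:
  assumes "v \<in> submanifold_tangent_space EA (\<pi> -` {x}) (\<sigma> x)"
  shows "P (v c) = 0"
proof -
  obtain e \<gamma> where v: "v \<in> tangent_space EA (\<sigma> x)" and e: "0 < e"
    and \<gamma>: "continuous_on {-e<..<e} \<gamma>" "\<And>t. t \<in> {-e<..<e} \<Longrightarrow> \<gamma> t \<in> \<pi> -` {x}" "\<gamma> 0 = \<sigma> x"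
    and vel: "((snd c \<circ> \<gamma>) has_vector_derivative v c) (at 0)"
    using assms c by (rule submanifold_tangent_spaceE) blast
  have "((snd d \<circ> (\<pi> \<circ> \<gamma>)) has_vector_derivative P (v c)) (at 0)"
    by (rule velocity_image[OF vel _ total_chart(3) _ e \<gamma>(1)])
      (simp_all add: \<gamma>(3) projection_has_deriv total_chart)
  moreover have "((snd d \<circ> (\<pi> \<circ> \<gamma>)) has_vector_derivative 0) (at 0)"
  proof (rule has_vector_derivative_transform_within_open)
    show "((\<lambda>_. snd d x) has_vector_derivative 0) (at 0)"
      by (rule has_vector_derivative_const)
    show "open {-e<..<e}" "0 \<in> {-e<..<e}"
      using e by auto
    fix t assume "t \<in> {-e<..<e}"
    then show "snd d x = (snd d \<circ> (\<pi> \<circ> \<gamma>)) t"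
      using \<gamma>(2)[of t] by simp
  qed
  ultimately show ?thesis
    by (rule vector_derivative_unique_at)
qed

text \<open>Let \<open>\<Phi>\<close> be a local trivialisation with inverse \<open>\<Psi>\<close>. As \<open>\<pi> = fst \<circ> \<Phi>\<close>, the derivative \<open>L\<close> of \<open>\<Phi>\<close>
  takes a vertical vector \<open>v\<close> to some \<open>(0, u)\<close>, and the derivative of \<open>\<Psi>\<close>, being a left inverse of \<open>L\<close>,
  takes \<open>(0, u)\<close> back to \<open>v\<close>. Hence \<open>v\<close> is the velocity of \<open>t \<mapsto> \<Psi> (x, t u)\<close>, which stays in the fibre.\<close>

lemma fibre_tangent_superset:
  assumes v: "v \<in> tangent_space EA (\<sigma> x)" and Pv: "P (v c) = 0"
  shows "v \<in> submanifold_tangent_space EA (\<pi> -` {x}) (\<sigma> x)"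
proof -
  obtain U \<Phi> where x: "x \<in> U" and triv: "local_trivialisation EA MA D \<pi> \<sigma> U \<Phi>"
    using disc unfolding disc_bundle_def by blast
  have D: "ball 0 1 \<subseteq> D"
    using disc unfolding disc_bundle_def by (auto simp: subset_iff)
  define \<Psi> where "\<Psi> = inv_into (\<pi> -` U) \<Phi>"
  define e where "e = (fst d \<times> (UNIV :: (real ^ 'k) set), map_prod (snd d) (id :: real ^ 'k \<Rightarrow> _))"
  \<comment> \<open>The open disc is used even if \<open>D\<close> is closed: derivatives are taken on open sets.\<close>
  let ?B = "U \<times> ball (0 :: real ^ 'k) 1"
  have U: "open U" and bij: "bij_betw \<Phi> (\<pi> -` U) (U \<times> D)"
    and fst_\<Phi>: "\<And>q. q \<in> \<pi> -` U \<Longrightarrow> fst (\<Phi> q) = \<pi> q"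
    and smooth_\<Phi>: "smooth_map EA (times_vec_atlas MA) (\<pi> -` U) \<Phi>"
    and "smooth_map (times_vec_atlas MA) EA (U \<times> D) \<Psi>" and \<Phi>\<sigma>: "\<Phi> (\<sigma> x) = (x, 0)"
    using triv x unfolding local_trivialisation_def \<Psi>_def by blast+
  then have smooth_\<Psi>: "smooth_map (times_vec_atlas MA) EA ?B \<Psi>"
    using D by (elim smooth_map_subset) auto
  have e_in: "e \<in> times_vec_atlas MA"
    unfolding times_vec_atlas_def e_def using base_chart(1) by blast
  have e_reg: "regular_chart e" and e_open: "open (snd e ` fst e)"
    using regular_chart_times_vec[OF base_chart(3,5)] by (simp_all add: e_def)
  have x0: "(x, 0) \<in> fst e" "(x, 0) \<in> ?B"
    using x base_chart(2) by (simp_all add: e_def)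
  have B: "open ?B"
    using U by (simp add: open_Times)
  have \<pi>U: "open (\<pi> -` U)" "\<sigma> x \<in> \<pi> -` U"
    using U x continuous_projection[of UNIV] by (auto simp: projection_section intro: open_vimage)
  have \<Psi>\<Phi>: "\<Psi> (\<Phi> q) = q" if "q \<in> \<pi> -` U" for q
    using that bij unfolding \<Psi>_def bij_betw_def by (simp add: inv_into_f_f)
  have \<Psi>x: "\<Psi> (x, 0) = \<sigma> x"
    using \<Psi>\<Phi>[OF \<pi>U(2)] by (simp add: \<Phi>\<sigma>)
  have "\<exists>L. chart_has_deriv c e \<Phi> (\<sigma> x) L"
    by (rule smooth_map_chart_has_deriv[OF smooth_\<Phi> \<pi>U total_chart(1) e_in total_chart(3)
          regular_chart_open[OF e_reg] total_chart(2)]) (simp add: \<Phi>\<sigma> x0)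
  then obtain L where L: "chart_has_deriv c e \<Phi> (\<sigma> x) L" ..
  have "\<exists>L'. chart_has_deriv e c \<Psi> (x, 0) L'"
    by (rule smooth_map_chart_has_deriv[OF smooth_\<Psi> B x0(2) e_in total_chart(1) e_reg total_chart(4) x0(1)])
      (simp add: \<Psi>x total_chart)
  then obtain L' where L': "chart_has_deriv e c \<Psi> (x, 0) L'" ..
  have cont_\<Phi>: "continuous_on (\<pi> -` U) \<Phi>"
    using smooth_\<Phi> by (simp add: smooth_map_def)
  note compose = chart_has_deriv_compose[OF L _ \<pi>U(1) cont_\<Phi> \<pi>U(2) total_chart(3,2) e_reg]
  have "chart_has_deriv c c (\<Psi> \<circ> \<Phi>) (\<sigma> x) (L' \<circ> L)"
    by (rule compose) (simp_all add: \<Phi>\<sigma> L' x0)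
  then have "chart_has_deriv c c id (\<sigma> x) (L' \<circ> L)"
    by (rule chart_has_deriv_cong[OF _ total_chart(3) \<pi>U(1) total_chart(2) \<pi>U(2)]) (simp add: \<Psi>\<Phi>)
  from chart_has_deriv_unique[OF total_chart(3,2) this chart_has_deriv_id[OF total_chart(3,2)]]
  have L'L: "L' (L u) = u" for u
    by (simp add: fun_eq_iff)
  have "chart_has_deriv e d fst (x, 0) fst"
    unfolding chart_has_deriv_def
  proof (rule has_derivative_transform)
    show "(fst has_derivative fst) (at (snd e (x, 0)) within snd e ` fst e)"
      by (rule bounded_linear_imp_has_derivative[OF bounded_linear_fst])
    show "snd e (x, 0) \<in> snd e ` fst e"
      using x0(1) by simp
    fix z assume "z \<in> snd e ` fst e"
    then obtain q where q: "q \<in> fst e" "z = snd e q" by blast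
    then show "(snd d \<circ> fst \<circ> cinv e) z = fst z"
      using cinv_chart[OF e_reg q(1)] by (cases q) (simp add: e_def)
  qed
  then have "chart_has_deriv c d (fst \<circ> \<Phi>) (\<sigma> x) (fst \<circ> L)"
    by (intro compose) (simp_all add: \<Phi>\<sigma> x0)
  then have "chart_has_deriv c d \<pi> (\<sigma> x) (fst \<circ> L)"
    by (rule chart_has_deriv_cong[OF _ total_chart(3) \<pi>U(1) total_chart(2) \<pi>U(2)]) (simp add: fst_\<Phi>)
  from chart_has_deriv_unique[OF total_chart(3,2) this projection_has_deriv]
  have "fst (L (v c)) = 0"
    using Pv by (metis comp_apply)
  then obtain u where u: "L (v c) = (0, u)"
    by (metis prod.collapse)
  define l where "l t = snd e (x, 0) + t *\<^sub>R (0, u)" for t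
  obtain \<epsilon> where \<epsilon>: "0 < \<epsilon>" "\<And>t. t \<in> {-\<epsilon><..<\<epsilon>} \<Longrightarrow> l t \<in> snd e ` (fst e \<inter> ?B)"
    "smooth_map real_atlas EA {-\<epsilon><..<\<epsilon>} (\<lambda>t. \<Psi> (cinv e (l t)))"
    "((snd c \<circ> (\<lambda>t. \<Psi> (cinv e (l t)))) has_vector_derivative L' (0, u)) (at 0)"
    unfolding l_def using coordinate_line[OF smooth_\<Psi> B e_in e_reg e_open x0 L', of "(0, u)"] by blast
  have "\<pi> (\<Psi> (cinv e (l t))) = x" if t: "t \<in> {-\<epsilon><..<\<epsilon>}" for t
  proof -
    obtain z where z: "z \<in> fst e" "z \<in> ?B" "l t = snd e z"
      using \<epsilon>(2)[OF t] by blast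
    have "snd d (fst z) = snd d x" "fst z \<in> fst d"
      using z by (cases z; simp add: l_def e_def)+
    then have fst_z: "fst z = x"
      using cinv_chart[OF base_chart(3)] base_chart(2) by metis
    have "z \<in> \<Phi> ` (\<pi> -` U)"
      using z(2) D bij by (auto simp: bij_betw_def)
    then have "\<Phi> (\<Psi> z) = z" "\<Psi> z \<in> \<pi> -` U"
      unfolding \<Psi>_def by (rule f_inv_into_f, rule inv_into_into)
    then show ?thesis
      using fst_\<Phi>[of "\<Psi> z"] fst_z cinv_chart[OF e_reg z(1)] by (simp add: z(3))
  qed
  moreover have "\<Psi> (cinv e (l 0)) = \<sigma> x"
    using cinv_chart[OF e_reg x0(1)] by (simp add: l_def \<Psi>x flip: zero_prod_def)
  moreover have "L' (0, u) = v c"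
    using L'L[of "v c"] by (simp add: u)
  ultimately show ?thesis
    using \<epsilon> by (intro submanifold_tangent_spaceI[OF total_atlas v c]) auto
qed

lemma perpendicular_iff:
  fixes g
  defines "G \<equiv> \<lambda>u w. g (\<sigma> x) (chart_vec EA (\<sigma> x) c u) (chart_vec EA (\<sigma> x) c w)"
  shows "perpendicular_at EA g (\<sigma> x) (\<pi> -` {x}) (range \<sigma>) \<longleftrightarrow> (\<forall>k w. P k = 0 \<longrightarrow> G k (S w) = 0)"
proof
  assume perp: "perpendicular_at EA g (\<sigma> x) (\<pi> -` {x}) (range \<sigma>)"
  show "\<forall>k w. P k = 0 \<longrightarrow> G k (S w) = 0"
  proof (intro allI impI)
    fix k w assume "P k = 0"
    then have "chart_vec EA (\<sigma> x) c k \<in> submanifold_tangent_space EA (\<pi> -` {x}) (\<sigma> x)"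
      by (intro fibre_tangent_superset chart_vec_tangent[OF total_atlas c]) (simp add: chart_vec_coord[OF total_atlas c])
    moreover have "chart_vec EA (\<sigma> x) c (S w) \<in> submanifold_tangent_space EA (range \<sigma>) (\<sigma> x)"
      unfolding zero_section_tangent_space
      using chart_vec_tangent[OF total_atlas c] chart_vec_coord[OF total_atlas c] by blast
    ultimately show "G k (S w) = 0"
      using perp unfolding perpendicular_at_def G_def by blast
  qed
next
  assume G: "\<forall>k w. P k = 0 \<longrightarrow> G k (S w) = 0"
  show "perpendicular_at EA g (\<sigma> x) (\<pi> -` {x}) (range \<sigma>)"
    unfolding perpendicular_at_def
  proof (intro ballI)
    fix v v' assume v: "v \<in> submanifold_tangent_space EA (\<pi> -` {x}) (\<sigma> x)"
      and v': "v' \<in> submanifold_tangent_space EA (range \<sigma>) (\<sigma> x)"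
    obtain w where w: "v' c = S w" and T': "v' \<in> tangent_space EA (\<sigma> x)"
      using v' unfolding zero_section_tangent_space by blast
    have T: "v \<in> tangent_space EA (\<sigma> x)"
      using v unfolding submanifold_tangent_space_def by blast
    have "G (v c) (v' c) = 0"
      using G fibre_tangent_subset[OF v] by (simp add: w)
    then show "g (\<sigma> x) v v' = 0"
      by (simp add: G_def chart_vec_of_coord[OF total_atlas c] T T')
  qed
qed

end

end

section \<open>The comass of the pulled-back volume form\<close>

text \<open>By \<open>simple_norm_wedge\<close> the norm of a simple \<open>m\<close>-vector may be computed from any tuple representing
  it, so the maximum over \<open>m\<close>-vectors is one over tuples, and these may be given by coordinates.\<close>

lemma comass_in_chart:
  fixes \<phi> :: "('a::{t2_space,second_countable_topology}, 'v::euclidean_space, 'm::finite) form"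
  assumes A: "smooth_atlas_bd A" and g: "riemannian_metric A g" and c: "c \<in> charts_at A p"
    and \<phi>: "\<phi> p \<in> alternating_forms A p"
  defines "G \<equiv> \<lambda>u w. g p (chart_vec A p c u) (chart_vec A p c w)"
  shows "comass A g p \<phi> = (GREATEST r. \<exists>y. sqrt (det (\<chi> i j. G (y i) (y j))) = 1 \<and>
    r = \<phi> p (\<lambda>i. chart_vec A p c (y i)))"
proof -
  have "(\<exists>V\<in>simple_mvecs A p. simple_norm A g p V = 1 \<and> r = V (\<phi> p)) \<longleftrightarrow>
      (\<exists>y. sqrt (det (\<chi> i j. G (y i) (y j))) = 1 \<and> r = \<phi> p (\<lambda>i. chart_vec A p c (y i)))" for r
  proof
    assume "\<exists>V\<in>simple_mvecs A p. simple_norm A g p V = 1 \<and> r = V (\<phi> p)"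
    then obtain v where v: "range v \<subseteq> tangent_space A p"
      "simple_norm A g p (wedge A p v) = 1" "r = wedge A p v (\<phi> p)"
      unfolding simple_mvecs_def by blast
    have cv: "chart_vec A p c (v i c) = v i" for i
      using v(1) by (intro chart_vec_of_coord[OF A c]) blast
    have "sqrt (det (\<chi> i j. G (v i c) (v j c))) = 1"
      using v(2) by (simp add: simple_norm_wedge[OF g v(1)] gram_def G_def cv)
    moreover have "r = \<phi> p (\<lambda>i. chart_vec A p c (v i c))"
      using v(3) \<phi> by (simp add: wedge_def cv)
    ultimately show "\<exists>y. sqrt (det (\<chi> i j. G (y i) (y j))) = 1 \<and> r = \<phi> p (\<lambda>i. chart_vec A p c (y i))"
      by (intro exI[of _ "\<lambda>i. v i c"] conjI)
  next
    assume "\<exists>y. sqrt (det (\<chi> i j. G (y i) (y j))) = 1 \<and> r = \<phi> p (\<lambda>i. chart_vec A p c (y i))"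
    then obtain y where y: "sqrt (det (\<chi> i j. G (y i) (y j))) = 1" "r = \<phi> p (\<lambda>i. chart_vec A p c (y i))"
      by blast
    let ?v = "\<lambda>i. chart_vec A p c (y i)"
    have v: "range ?v \<subseteq> tangent_space A p"
      using chart_vec_tangent[OF A c] by blast
    have "simple_norm A g p (wedge A p ?v) = 1"
      using y(1) by (simp add: simple_norm_wedge[OF g v] gram_def G_def)
    moreover have "r = wedge A p ?v (\<phi> p)"
      using \<phi> by (simp add: wedge_def y(2))
    moreover have "wedge A p ?v \<in> simple_mvecs A p"
      unfolding simple_mvecs_def using v by blast
    ultimately show "\<exists>V\<in>simple_mvecs A p. simple_norm A g p V = 1 \<and> r = V (\<phi> p)"
      by blast
  qed
  then show ?thesis
    unfolding comass_def by simp
qed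

text \<open>Needed because an \<open>m\<close>-vector is a function on alternating forms only, and is undefined
  elsewhere.\<close>

lemma linear_det_alternating:
  fixes P :: "'v::euclidean_space \<Rightarrow> real ^ 'm"
  assumes P: "linear P"
  shows "(\<lambda>v. C * det (\<chi> i j. P (v j c) $ i)) \<in> alternating_forms A p"
proof -
  \<comment> \<open>The columns \<open>P (v j c)\<close> become rows, since \<open>det_row_add\<close> and \<open>det_row_mul\<close> concern rows.\<close>
  have tr: "det (\<chi> i j. P (v j c) $ i) = det (\<chi> k. P (v k c))" for v :: "'m \<Rightarrow> ('a, 'v) tvec"
    by (subst det_transpose[symmetric], rule arg_cong[where f = det]) (simp add: transpose_def vec_eq_iff)
  have "det (\<chi> k. P ((v(i := tcomb a u b w)) k c)) =
      a * det (\<chi> k. P ((v(i := u)) k c)) + b * det (\<chi> k. P ((v(i := w)) k c))"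
    for v :: "'m \<Rightarrow> ('a, 'v) tvec" and i u w a b
  proof -
    have upd: "det (\<chi> k. P ((v(i := z)) k c)) = det (\<chi> k. if k = i then P (z c) else P (v k c))" for z
      by (rule arg_cong[where f = det]) (simp add: vec_eq_iff)
    have "P (tcomb a u b w c) = a *s P (u c) + b *s P (w c)"
      using P by (simp add: tcomb_def linear_add linear_cmul scalar_mult_eq_scaleR)
    then show ?thesis
      unfolding upd det_row_mul[symmetric] by (simp only: det_row_add)
  qed
  moreover have "det (\<chi> k. P (v k c)) = 0" if "i \<noteq> j" "v i = v j" for v :: "'m \<Rightarrow> ('a, 'v) tvec" and i j
    by (rule det_identical_rows[OF that(1)]) (simp add: row_def vec_eq_iff that)
  ultimately show ?thesis
    unfolding alternating_forms_def tr by (auto simp: algebra_simps)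
qed

lemma tangent_map_eq_chart_vec:
  assumes A: "smooth_atlas_bd A" and B: "smooth_atlas_bd B" and f: "smooth_map A B UNIV f"
    and d: "d \<in> charts_at B (f p)"
  defines "c \<equiv> SOME c. c \<in> charts_at A p"
  shows "tangent_map A B f p v = chart_vec B (f p) d (chart_deriv c d f p (v c))"
proof -
  have c: "c \<in> charts_at A p"
    unfolding c_def by (rule some_chart_at[OF A])
  show ?thesis
    using chart_deriv_change[OF A B f c d]
    by (simp add: tangent_map_def chart_vec_def fun_eq_iff flip: c_def)
qed

theorem lemma2p15:
  fixes EA :: "('e::{t2_space,second_countable_topology}, real ^ 'n) chart set"
    and MA :: "('b::{t2_space,second_countable_topology}, real ^ 'm) chart set"
    and D :: "(real ^ 'k) set"
    and \<pi> :: "'e \<Rightarrow> 'b" and \<sigma> :: "'b \<Rightarrow> 'e"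
    and g :: "('e, real ^ 'n) metric_field"
  assumes "disc_bundle EA MA D \<pi> \<sigma>"
    and "oriented_atlas MA"
    and "riemannian_metric EA g"
  shows "(\<forall>x. perpendicular_at EA g (\<sigma> x) (\<pi> -` {x}) (range \<sigma>)) \<longleftrightarrow>
    (\<forall>x. comass EA g (\<sigma> x)
       (pullback_form EA MA \<pi> (volume_form MA (pullback_metric MA EA \<sigma> g))) = 1)"
proof -
  note disc = assms(1) and g = assms(3)
  note EA = total_atlas[OF disc] and MA = base_atlas[OF disc]
  let ?\<omega> = "pullback_form EA MA \<pi> (volume_form MA (pullback_metric MA EA \<sigma> g))"
  have "perpendicular_at EA g (\<sigma> x) (\<pi> -` {x}) (range \<sigma>) \<longleftrightarrow> comass EA g (\<sigma> x) ?\<omega> = 1" for x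
  proof -
    define c where "c = (SOME c. c \<in> charts_at EA (\<sigma> x))"
    define d where "d = (SOME d. d \<in> charts_at MA x)"
    have c: "c \<in> charts_at EA (\<sigma> x)"
      unfolding c_def by (rule some_chart_at[OF EA])
    have d: "d \<in> charts_at MA x"
      unfolding d_def by (rule some_chart_at[OF MA])
    define P where "P = chart_deriv c d \<pi> (\<sigma> x)"
    define S where "S = chart_deriv d c \<sigma> x"
    define G where "G u w = g (\<sigma> x) (chart_vec EA (\<sigma> x) c u) (chart_vec EA (\<sigma> x) c w)" for u w
    define C where "C = sqrt (det (\<chi> i j. G (S (axis i 1)) (S (axis j 1))))"
    have projection_section: "\<pi> (\<sigma> x) = x"
      by (rule projection_section[OF disc])
    have P: "linear P"
      unfolding P_def by (rule chart_has_deriv_linear[OF projection_has_deriv[OF disc c d]])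
    have S: "linear S"
      unfolding S_def by (rule chart_has_deriv_linear[OF section_has_deriv[OF disc c d]])
    have PS: "P (S w) = w" for w
      unfolding P_def S_def by (rule projection_section_deriv[OF disc c d])
    have d': "d \<in> charts_at MA (\<pi> (\<sigma> x))"
      using d by (simp add: projection_section)
    have d\<pi>: "tangent_map EA MA \<pi> (\<sigma> x) v d = P (v c)" for v
      using tangent_map_eq_chart_vec[OF EA MA smooth_projection[OF disc] d', of v] chart_vec_coord[OF MA d]
      by (simp add: projection_section P_def flip: c_def)
    have d\<sigma>: "tangent_map MA EA \<sigma> x (chart_vec MA x d u) = chart_vec EA (\<sigma> x) c (S u)" for u
      using tangent_map_eq_chart_vec[OF MA EA smooth_section[OF disc] c, of "chart_vec MA x d u"]
      by (simp add: S_def chart_vec_coord[OF MA d] flip: d_def)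
    have \<omega>: "?\<omega> (\<sigma> x) = (\<lambda>v. C * det (\<chi> i j. P (v j c) $ i))"
      by (rule ext) (simp add: pullback_form_def volume_form_def pullback_metric_def projection_section d\<pi> d\<sigma>
          C_def G_def flip: d_def)
    have "comass EA g (\<sigma> x) ?\<omega> = (GREATEST r. \<exists>y. sqrt (det (\<chi> i j. G (y i) (y j))) = 1 \<and>
        r = C * det (\<chi> i j. P (y j) $ i))"
      using comass_in_chart[OF EA g c, of ?\<omega>]
      by (simp add: \<omega> linear_det_alternating[OF P] chart_vec_coord[OF EA c] flip: G_def)
    then have "comass EA g (\<sigma> x) ?\<omega> = 1 \<longleftrightarrow> (\<forall>k w. P k = 0 \<longrightarrow> G k (S w) = 0)"
      unfolding C_def
      using max_pulled_back_volume_eq_1_iff[of G P S, OF _ _ _ P S PS] metric_in_chart[OF EA g c]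
      by (simp add: G_def[abs_def])
    also have "\<dots> \<longleftrightarrow> perpendicular_at EA g (\<sigma> x) (\<pi> -` {x}) (range \<sigma>)"
      unfolding P_def S_def G_def by (rule perpendicular_iff[OF disc c d, symmetric])
    finally show ?thesis
      by simp
  qed
  then show ?thesis
    by simp
qed

end
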